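(* Let $A_1,A_2$ be real $2\times2$ matrices with determinant $1$ and with upper-right entries $b_1,b_2\neq0$. Let $\phi\in L^2(\mathbb{R}^2,\mathbb{H})$ be a quaternion window function and $f\in L^2(\mathbb{R}^2,\mathbb{H})$ such that $f,\phi\neq0$ and $|b_1b_2|\ge\frac1{4\pi^2}$. Then $$E\big(|G_{\phi}^{A_1,A_2}\{f\}|^{2}\big)\;\ge\;\frac{1}{2\pi^{2}}\big(\ln(2)-\ln(2\pi)-\ln(|b_1b_2|)\big)\|f\|^{2}_{L^2(\mathbb{R}^2,\mathbb{H})}\|\phi\|^{2}_{L^2(\mathbb{R}^2,\mathbb{H})}-\|f\|^{2}_{L^2(\mathbb{R}^2,\mathbb{H})}\|\phi\|^{2}_{L^2(\mathbb{R}^2,\mathbb{H})}\ln\big(\|f\|^{2}_{L^2(\mathbb{R}^2,\mathbb{H})}\|\phi\|^{2}_{L^2(\mathbb{R}^2,\mathbb{H})}\big).$$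
   Context: $\mathbb{H}$ is the real quaternion algebra with units $\mathbf{i},\mathbf{j},\mathbf{k}$, conjugation $q\mapsto\overline q$ and norm $|q|=\sqrt{q\overline q}$. $L^2(\mathbb{R}^2,\mathbb{H})$ is the space of $f:\mathbb{R}^2\to\mathbb{H}$ with $\|f\|_{L^2}=(\int|f(\mathbf{x})|^2 d\mathbf{x})^{1/2}<\infty$. Let $A_i=\begin{bmatrix}a_i&b_i\\c_i&d_i\end{bmatrix}\in\mathbb{R}^{2\times2}$, $\det A_i=1$, $b_i\ne0$, $i=1,2$. Kernels: $$K_{A_1}^{\mathbf{i}}(x_1,\omega_1)=\tfrac{1}{\sqrt{2\pi b_1}}e^{\mathbf{i}\left(\frac{a_1}{2b_1}x_1^2-\frac{x_1\omega_1}{b_1}+\frac{d_1}{2b_1}\omega_1^2-\frac{\pi}{4}\right)},\qquad K_{A_2}^{\mathbf{j}}(x_2,\omega_2)=\tfrac{1}{\sqrt{2\pi b_2}}e^{\mathbf{j}\left(\frac{a_2}{2b_2}x_2^2-\frac{x_2\omega_2}{b_2}+\frac{d_2}{2b_2}\omega_2^2-\frac{\pi}{4}\right)}$$ (for $b_i<0$ the square root is the principal one in $\mathbb{R}+\mathbb{R}\mathbf{i}$, resp. $\mathbb{R}+\mathbb{R}\mathbf{j}$). For $\phi\in L^2(\mathbb{R}^2,\mathbb{H})\setminus\{0\}$ (a quaternion window function) and $f\in L^2(\mathbb{R}^2,\mathbb{H})$, the two-sided quaternion windowed linear canonical transform (QWLCT) is $$G^{A_1,A_2}_{\phi}\{f\}(\mathbf{w},\mathbf{u})=\int_{\mathbb{R}^2}K_{A_1}^{\mathbf{i}}(x_1,\omega_1)\,f(\mathbf{x})\,\overline{\phi(\mathbf{x}-\mathbf{u})}\,K_{A_2}^{\mathbf{j}}(x_2,\omega_2)\,d\mathbf{x},\qquad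 \mathbf{w}=(\omega_1,\omega_2),\ \mathbf{u}\in\mathbb{R}^2.$$ The (Shannon) entropy of a nonnegative integrable function $p$ on $\mathbb{R}^2\times\mathbb{R}^2$ is $$E(p)=-\int_{\mathbb{R}^2}\int_{\mathbb{R}^2}\ln(p(\mathbf{w},\mathbf{u}))\,p(\mathbf{w},\mathbf{u})\,d\mathbf{w}\,d\mathbf{u},$$ with $0\ln0=0$; the value $+\infty$ is allowed. *)

theory Defs
  imports "HOL-Analysis.Analysis"
begin

section \<open>Quaternions\<close>

codatatype quat = Quat (qRe: real) (qIm1: real) (qIm2: real) (qIm3: real)

lemma quat_eq_iff:
  "x = y \<longleftrightarrow> qRe x = qRe y \<and> qIm1 x = qIm1 y \<and> qIm2 x = qIm2 y \<and> qIm3 x = qIm3 y"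
  by (auto intro: quat.expand)

instantiation quat :: ab_group_add
begin

primcorec zero_quat where
  "qRe 0 = 0" | "qIm1 0 = 0" | "qIm2 0 = 0" | "qIm3 0 = 0"

primcorec plus_quat where
  "qRe (x + y) = qRe x + qRe y"
| "qIm1 (x + y) = qIm1 x + qIm1 y"
| "qIm2 (x + y) = qIm2 x + qIm2 y"
| "qIm3 (x + y) = qIm3 x + qIm3 y"

primcorec uminus_quat where
  "qRe (- x) = - qRe x"
| "qIm1 (- x) = - qIm1 x"
| "qIm2 (- x) = - qIm2 x"
| "qIm3 (- x) = - qIm3 x"

primcorec minus_quat where
  "qRe (x - y) = qRe x - qRe y"
| "qIm1 (x - y) = qIm1 x - qIm1 y"
| "qIm2 (x - y) = qIm2 x - qIm2 y"
| "qIm3 (x - y) = qIm3 x - qIm3 y"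

instance
  by standard (simp_all add: quat_eq_iff)

end

instantiation quat :: real_div_algebra
begin

primcorec one_quat where
  "qRe 1 = 1" | "qIm1 1 = 0" | "qIm2 1 = 0" | "qIm3 1 = 0"

primcorec times_quat where
  "qRe (x * y) = qRe x * qRe y - qIm1 x * qIm1 y - qIm2 x * qIm2 y - qIm3 x * qIm3 y"
| "qIm1 (x * y) = qRe x * qIm1 y + qIm1 x * qRe y + qIm2 x * qIm3 y - qIm3 x * qIm2 y"
| "qIm2 (x * y) = qRe x * qIm2 y - qIm1 x * qIm3 y + qIm2 x * qRe y + qIm3 x * qIm1 y"
| "qIm3 (x * y) = qRe x * qIm3 y + qIm1 x * qIm2 y - qIm2 x * qIm1 y + qIm3 x * qRe y"

primcorec scaleR_quat where
  "qRe (r *\<^sub>R x) = r * qRe x"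
| "qIm1 (r *\<^sub>R x) = r * qIm1 x"
| "qIm2 (r *\<^sub>R x) = r * qIm2 x"
| "qIm3 (r *\<^sub>R x) = r * qIm3 x"

primcorec inverse_quat where
  "qRe (inverse x) = qRe x / ((qRe x)\<^sup>2 + (qIm1 x)\<^sup>2 + (qIm2 x)\<^sup>2 + (qIm3 x)\<^sup>2)"
| "qIm1 (inverse x) = - qIm1 x / ((qRe x)\<^sup>2 + (qIm1 x)\<^sup>2 + (qIm2 x)\<^sup>2 + (qIm3 x)\<^sup>2)"
| "qIm2 (inverse x) = - qIm2 x / ((qRe x)\<^sup>2 + (qIm1 x)\<^sup>2 + (qIm2 x)\<^sup>2 + (qIm3 x)\<^sup>2)"
| "qIm3 (inverse x) = - qIm3 x / ((qRe x)\<^sup>2 + (qIm1 x)\<^sup>2 + (qIm2 x)\<^sup>2 + (qIm3 x)\<^sup>2)"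

definition "x div y = x * inverse y" for x y :: quat

lemma quat_sum_squares_eq_0:
  "(qRe x)\<^sup>2 + (qIm1 x)\<^sup>2 + (qIm2 x)\<^sup>2 + (qIm3 x)\<^sup>2 = 0 \<longleftrightarrow> x = (0::quat)"
  by (auto simp: quat_eq_iff add_nonneg_eq_0_iff)

instance
proof
  fix x y z :: quat and a b :: real
  show "x * y * z = x * (y * z)" "(x + y) * z = x * z + y * z" "x * (y + z) = x * y + x * z"
    by (simp_all add: quat_eq_iff algebra_simps)
  show "1 * x = x" "x * 1 = x" "(0::quat) \<noteq> 1"
    by (simp_all add: quat_eq_iff)
  show "a *\<^sub>R (x + y) = a *\<^sub>R x + a *\<^sub>R y" "(a + b) *\<^sub>R x = a *\<^sub>R x + b *\<^sub>R x"
    "a *\<^sub>R b *\<^sub>R x = (a * b) *\<^sub>R x" "1 *\<^sub>R x = x"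
    "a *\<^sub>R x * y = a *\<^sub>R (x * y)" "x * a *\<^sub>R y = a *\<^sub>R (x * y)"
    by (simp_all add: quat_eq_iff algebra_simps)
  show "x div y = x * inverse y"
    by (rule divide_quat_def)
  show "inverse (0::quat) = 0"
    by (simp add: quat_eq_iff)
next
  fix x :: quat
  define n where "n = (qRe x)\<^sup>2 + (qIm1 x)\<^sup>2 + (qIm2 x)\<^sup>2 + (qIm3 x)\<^sup>2"
  assume "x \<noteq> 0"
  then have n: "n \<noteq> 0"
    by (simp add: n_def quat_sum_squares_eq_0)
  have *: "qRe x * (qRe x / n) + qIm1 x * (qIm1 x / n) + qIm2 x * (qIm2 x / n)
      + qIm3 x * (qIm3 x / n) = 1"
    using n by (simp add: n_def power2_eq_square flip: add_divide_distrib)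
  show "inverse x * x = 1"
    using * by (simp add: quat_eq_iff flip: n_def)
  show "x * inverse x = 1"
    using * by (simp add: quat_eq_iff flip: n_def)
qed

end

instantiation quat :: real_inner
begin

definition inner_quat :: "quat \<Rightarrow> quat \<Rightarrow> real" where
  "inner_quat x y = qRe x * qRe y + qIm1 x * qIm1 y + qIm2 x * qIm2 y + qIm3 x * qIm3 y"

definition norm_quat :: "quat \<Rightarrow> real" where
  "norm_quat x = sqrt ((qRe x)\<^sup>2 + (qIm1 x)\<^sup>2 + (qIm2 x)\<^sup>2 + (qIm3 x)\<^sup>2)"

definition sgn_quat :: "quat \<Rightarrow> quat" where
  "sgn_quat x = x /\<^sub>R norm x"

definition dist_quat :: "quat \<Rightarrow> quat \<Rightarrow> real" where
  "dist_quat x y = norm (x - y)"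

definition uniformity_quat :: "(quat \<times> quat) filter" where
  "uniformity_quat = (INF e\<in>{0<..}. principal {(x, y). dist x y < e})"

definition open_quat :: "quat set \<Rightarrow> bool" where
  "open_quat U \<longleftrightarrow> (\<forall>x\<in>U. eventually (\<lambda>(x', y). x' = x \<longrightarrow> y \<in> U) uniformity)"

instance
proof
  fix x y z :: quat and r :: real and U :: "quat set"
  show "sgn x = x /\<^sub>R norm x" by (rule sgn_quat_def)
  show "dist x y = norm (x - y)" by (rule dist_quat_def)
  show "uniformity = (INF e\<in>{0<..}. principal {(x, y :: quat). dist x y < e})"
    by (rule uniformity_quat_def)
  show "open U \<longleftrightarrow> (\<forall>x\<in>U. eventually (\<lambda>(x', y). x' = x \<longrightarrow> y \<in> U) uniformity)"
    by (rule open_quat_def)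
  show "inner x y = inner y x" "inner (x + y) z = inner x z + inner y z"
    "inner (r *\<^sub>R x) y = r * inner x y"
    by (simp_all add: inner_quat_def algebra_simps)
  show "0 \<le> inner x x"
    by (simp add: inner_quat_def)
  show "inner x x = 0 \<longleftrightarrow> x = 0"
    using quat_sum_squares_eq_0[of x] by (simp add: inner_quat_def power2_eq_square)
  show "norm x = sqrt (inner x x)"
    by (simp add: inner_quat_def norm_quat_def power2_eq_square)
qed

end

instance quat :: real_normed_div_algebra
proof
  fix x y :: quat
  show "norm (x * y) = norm x * norm y"
    unfolding norm_quat_def real_sqrt_mult[symmetric]
    by (rule arg_cong[where f = sqrt]) (simp add: power2_eq_square algebra_simps)
qed

definition quat_i :: quat where "quat_i = Quat 0 1 0 0"
definition quat_j :: quat where "quat_j = Quat 0 0 1 0"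
definition quat_k :: quat where "quat_k = Quat 0 0 0 1"

instantiation quat :: euclidean_space
begin

definition Basis_quat :: "quat set" where
  "Basis_quat = {1, quat_i, quat_j, quat_k}"

instance
proof
  show "(Basis :: quat set) \<noteq> {}" "finite (Basis :: quat set)"
    by (simp_all add: Basis_quat_def)
  show "inner u v = (if u = v then 1 else 0)" if "u \<in> Basis" "v \<in> Basis" for u v :: quat
    using that unfolding Basis_quat_def
    by (elim insertE emptyE)
      (simp_all add: inner_quat_def quat_eq_iff quat_i_def quat_j_def quat_k_def)
  show "(\<forall>u\<in>Basis. inner x u = 0) \<longleftrightarrow> x = 0" for x :: quat
    unfolding Basis_quat_def ball_simps
    by (simp add: inner_quat_def quat_eq_iff quat_i_def quat_j_def quat_k_def)
qed

end

lemma quat_units: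
  "quat_i * quat_i = -1" "quat_j * quat_j = -1" "quat_k * quat_k = -1"
  "quat_i * quat_j = quat_k" "quat_j * quat_k = quat_i" "quat_k * quat_i = quat_j"
  by (simp_all add: quat_i_def quat_j_def quat_k_def quat_eq_iff)

primcorec qcnj :: "quat \<Rightarrow> quat" where
  "qRe (qcnj q) = qRe q"
| "qIm1 (qcnj q) = - qIm1 q"
| "qIm2 (qcnj q) = - qIm2 q"
| "qIm3 (qcnj q) = - qIm3 q"

lemma mult_qcnj: "q * qcnj q = of_real ((norm q)\<^sup>2)"
  by (simp add: norm_quat_def quat_eq_iff of_real_def power2_eq_square algebra_simps)


section \<open>Quaternion-valued square-integrable functions\<close>

definition L2_fun :: "(real \<times> real \<Rightarrow> quat) \<Rightarrow> bool" where
  "L2_fun f \<longleftrightarrow> f \<in> borel_measurable lebesgue \<and> integrable lebesgue (\<lambda>x. (norm (f x))\<^sup>2)"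

definition L2_norm :: "(real \<times> real \<Rightarrow> quat) \<Rightarrow> real" where
  "L2_norm f = sqrt (LINT x|lebesgue. (norm (f x))\<^sup>2)"

text \<open>Functions equal almost everywhere are the same element of \<open>L\<^sup>2\<close>, so this is \<open>f \<noteq> 0\<close> there.\<close>

definition L2_nonzero :: "(real \<times> real \<Rightarrow> quat) \<Rightarrow> bool" where
  "L2_nonzero f \<longleftrightarrow> \<not> (AE x in lebesgue. f x = 0)"


section \<open>The two-sided quaternion windowed linear canonical transform\<close>

text \<open>The copy \<open>\<real> + \<real>u\<close> of the complex numbers in the quaternions, for an imaginary unit \<open>u\<close>.\<close>

definition quat_slice :: "quat \<Rightarrow> complex \<Rightarrow> quat" where
  "quat_slice u z = of_real (Re z) + Im z *\<^sub>R u"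

text \<open>The square root is the principal one in \<open>\<real> + \<real>u\<close>; it is not real when the upper-right entry
  \<open>b\<close> is negative. All factors lie in \<open>\<real> + \<real>u\<close> and hence commute.\<close>

definition LCT_kernel :: "quat \<Rightarrow> real^2^2 \<Rightarrow> real \<Rightarrow> real \<Rightarrow> quat" where
  "LCT_kernel u A x \<omega> =
    (let a = A $ 1 $ 1; b = A $ 1 $ 2; d = A $ 2 $ 2 in
      1 / quat_slice u (csqrt (of_real (2 * pi * b))) *
      exp ((a / (2 * b) * x\<^sup>2 - x * \<omega> / b + d / (2 * b) * \<omega>\<^sup>2 - pi / 4) *\<^sub>R u))"

definition QWLCT :: "real^2^2 \<Rightarrow> real^2^2 \<Rightarrow> (real \<times> real \<Rightarrow> quat) \<Rightarrow> (real \<times> real \<Rightarrow> quat) \<Rightarrow>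
    real \<times> real \<Rightarrow> real \<times> real \<Rightarrow> quat" where
  "QWLCT A\<^sub>1 A\<^sub>2 \<phi> f w u =
    (LINT x|lebesgue. LCT_kernel quat_i A\<^sub>1 (fst x) (fst w) * f x * qcnj (\<phi> (x - u)) *
      LCT_kernel quat_j A\<^sub>2 (snd x) (snd w))"


section \<open>Entropy\<close>

text \<open>Minus the integral of \<open>p ln p\<close>, as the difference of the integrals of the positive and the
  negative part of \<open>p ln p\<close> (\<^const>\<open>ennreal\<close> truncates at 0). In \<^typ>\<open>ereal\<close> we have
  \<open>\<infinity> - \<infinity> = \<infinity>\<close>, so if both are infinite the value is \<open>- \<infinity>\<close>, and a lower bound on the entropy
  is not satisfied vacuously.\<close>

definition shannon_entropy :: "((real \<times> real) \<times> (real \<times> real) \<Rightarrow> real) \<Rightarrow> ereal" where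
  "shannon_entropy p =
    - (enn2ereal (\<integral>\<^sup>+z. ennreal (ln (p z) * p z) \<partial>lebesgue)
       - enn2ereal (\<integral>\<^sup>+z. ennreal (- (ln (p z) * p z)) \<partial>lebesgue))"

end

theory Submission
  imports Defs "HOL-Probability.Characteristic_Functions"
begin

text \<open>Write \<open>p = |G|\<^sup>2\<close>, \<open>N = \<parallel>f\<parallel>\<^sup>2 \<parallel>\<phi>\<parallel>\<^sup>2\<close>, \<open>B = |b\<^sub>1 b\<^sub>2|\<close> and \<open>M = N / (4 \<pi>\<^sup>2 B)\<close>. The bound \<open>p \<le> M\<close>,
which Cauchy--Schwarz gives at once, yields only the entropy \<open>- N ln M\<close>. This falls short of the claim
when \<open>B\<close> is close to \<open>1 / (4 \<pi>\<^sup>2)\<close>, where a fixed positive gain is needed. The gain comes from the second moment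
of \<open>p\<close>: since \<open>ln t \<le> t - 1\<close>,
  \<open>- p ln p \<ge> p - p\<^sup>2 / M - p ln M\<close>
pointwise, so \<open>\<integral> p = N\<close> together with \<open>\<integral> p\<^sup>2 \<le> M N / 2\<close> gives entropy at least \<open>N / 2 - N ln M\<close>
(\<open>entropy_ge\<close>), and \<open>ln (4 \<pi>) \<le> \<pi>\<^sup>2\<close> shows that this is at least the asserted bound
(\<open>entropy_numerical_gap\<close>).

Both moments reduce to complex Fourier analysis. Each quaternion \<open>q\<close> has two complex coordinates
\<open>q\<^sub>+\<close>, \<open>q\<^sub>-\<close> with \<open>|q|\<^sup>2 = (|q\<^sub>+|\<^sup>2 + |q\<^sub>-|\<^sup>2) / 2\<close>, chosen so that multiplying from the left
in \<open>\<real> + \<real>\<i>\<close> and from the right in \<open>\<real> + \<real>j\<close> becomes multiplication of \<open>q\<^sub>+\<close> by \<open>a b\<^sup>*\<close> and of \<open>q\<^sub>-\<close>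
by \<open>a b\<close> (\<open>quat_plus_two_sided\<close>, \<open>quat_minus_two_sided\<close>). For fixed \<open>u\<close> the coordinates of \<open>G\<close> are
therefore rescaled Fourier transforms of the coordinates of \<open>h\<^sub>u(x) = f(x) \<phi>(x - u)\<^sup>*\<close>, up to quadratic
phases that do not change absolute values.

The first moment is then Plancherel's theorem (\<open>plancherel\<close>) followed by Tonelli. For the second moment,
\<open>F(g)\<^sup>2 = F(g * g)\<close> and Plancherel's theorem turn the fourth power of a Fourier transform into the square
of an autoconvolution (\<open>fourier_fourth_power_le\<close>). Cauchy--Schwarz, applied to
\<open>\<integral> f(x) f(m - x) \<cdot> \<phi>(x - u) \<phi>(m - x - u) dx\<close>, separates \<open>f\<close> from \<open>\<phi>\<close>; the latter enters through
\<open>m - 2u\<close>, so integrating over \<open>u\<close> produces the decisive factor \<open>2\<^sup>-\<^sup>2\<close> (\<open>nn_integral_autoconv_windowed\<close>).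
The quaternionic splitting costs a factor \<open>2\<close>, and \<open>1/2\<close> remains.\<close>

section \<open>Affine substitutions in Lebesgue integrals\<close>

lemma nn_integral_lborel_affine:
  fixes f :: "'a::euclidean_space \<Rightarrow> ennreal"
  assumes [measurable]: "f \<in> borel_measurable borel" and c: "c \<noteq> 0"
  shows "(\<integral>\<^sup>+x. f x \<partial>lborel) = ennreal (\<bar>c\<bar> ^ DIM('a)) * (\<integral>\<^sup>+x. f (t + c *\<^sub>R x) \<partial>lborel)"
  by (subst lborel_affine[OF c, of t])
     (simp add: nn_integral_density nn_integral_distr nn_integral_cmult ennreal_power)

lemma nn_integral_lborel_translate:
  fixes f :: "'a::euclidean_space \<Rightarrow> ennreal"
  assumes [measurable]: "f \<in> borel_measurable borel"
  shows "(\<integral>\<^sup>+x. f (x - a) \<partial>lborel) = (\<integral>\<^sup>+x. f x \<partial>lborel)"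
  using nn_integral_lborel_affine[of f 1 "-a"] by (simp add: algebra_simps)

lemma nn_integral_lborel_reflect:
  fixes f :: "'a::euclidean_space \<Rightarrow> ennreal"
  assumes [measurable]: "f \<in> borel_measurable borel"
  shows "(\<integral>\<^sup>+x. f (a - x) \<partial>lborel) = (\<integral>\<^sup>+x. f x \<partial>lborel)"
  using nn_integral_lborel_affine[of f "-1" "a"] by (simp add: algebra_simps)

lemma integrable_lborel_affine:
  fixes f :: "'a::euclidean_space \<Rightarrow> 'b::{banach, second_countable_topology}"
  assumes "integrable lborel f" and c: "c \<noteq> 0"
  shows "integrable lborel (\<lambda>x. f (t + c *\<^sub>R x))"
proof -
  have [measurable]: "f \<in> borel_measurable borel" using assms by auto
  have "integrable (density (distr lborel borel (\<lambda>x. t + c *\<^sub>R x)) (\<lambda>_. \<bar>c\<bar> ^ DIM('a))) f"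
    using assms lborel_affine[OF c, of t] by simp
  then have "integrable (distr lborel borel (\<lambda>x. t + c *\<^sub>R x)) (\<lambda>x. (\<bar>c\<bar> ^ DIM('a)) *\<^sub>R f x)"
    by (subst (asm) integrable_density) (auto simp: ennreal_power)
  then have "integrable lborel (\<lambda>x. (\<bar>c\<bar> ^ DIM('a)) *\<^sub>R f (t + c *\<^sub>R x))"
    by (subst (asm) integrable_distr_eq) auto
  from integrable_scaleR_right[OF this, of "inverse (\<bar>c\<bar> ^ DIM('a))"] show ?thesis
    using c by simp
qed

lemma integral_lborel_affine:
  fixes f :: "'a::euclidean_space \<Rightarrow> 'b::{banach, second_countable_topology}"
  assumes [measurable]: "f \<in> borel_measurable borel" and c: "c \<noteq> 0"
  shows "(LINT x|lborel. f x) = (\<bar>c\<bar> ^ DIM('a)) *\<^sub>R (LINT x|lborel. f (t + c *\<^sub>R x))"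
  by (subst lborel_affine[OF c, of t])
     (simp add: integral_density integral_distr)

lemma integrable_lborel_translate:
  fixes f :: "'a::euclidean_space \<Rightarrow> 'b::{banach, second_countable_topology}"
  assumes "integrable lborel f"
  shows "integrable lborel (\<lambda>x. f (x - a))"
  using integrable_lborel_affine[OF assms, of 1 "-a"] by simp

lemma integral_lborel_translate:
  fixes f :: "'a::euclidean_space \<Rightarrow> 'b::{banach, second_countable_topology}"
  assumes "f \<in> borel_measurable borel"
  shows "(LINT x|lborel. f (x - a)) = (LINT x|lborel. f x)"
  using integral_lborel_affine[OF assms, of 1 "-a"] by simp

section \<open>Continuity of translations in mean\<close>

text \<open>Sequences suffice to express the limit \<open>y \<rightarrow> 0\<close>, and they allow dominated convergence.\<close>

definition L1_translation_continuous :: "('a::euclidean_space \<Rightarrow> real) \<Rightarrow> bool" where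
  "L1_translation_continuous f \<longleftrightarrow>
     (\<forall>y. y \<longlonglongrightarrow> 0 \<longrightarrow> (\<lambda>n. LINT x|lborel. \<bar>f (x - y n) - f x\<bar>) \<longlonglongrightarrow> 0)"

text \<open>Translations are isometries of \<open>L\<^sup>1\<close>, so the triangle inequality makes this class closed in \<open>L\<^sup>1\<close>.
Both approximation steps below, from open to measurable sets and from simple to integrable functions,
rest on this.\<close>

lemma L1_translation_continuous_closed:
  fixes f :: "'a::euclidean_space \<Rightarrow> real"
  assumes f: "integrable lborel f"
    and approx: "\<And>e. e > 0 \<Longrightarrow> \<exists>g. integrable lborel g \<and> L1_translation_continuous g \<and> (LINT x|lborel. \<bar>f x - g x\<bar>) < e"
  shows "L1_translation_continuous f"
  unfolding L1_translation_continuous_def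
proof (intro allI impI LIMSEQ_I)
  fix y :: "nat \<Rightarrow> 'a" and e :: real
  assume y: "y \<longlonglongrightarrow> 0" and e: "e > 0"
  obtain g where g: "integrable lborel g" "L1_translation_continuous g" "(LINT x|lborel. \<bar>f x - g x\<bar>) < e / 3"
    using approx[of "e/3"] e by auto
  have [measurable]: "f \<in> borel_measurable borel" "g \<in> borel_measurable borel"
    using f g by auto
  have "\<forall>\<^sub>F n in sequentially. (LINT x|lborel. \<bar>g (x - y n) - g x\<bar>) < e / 3"
    using g(2) y e unfolding L1_translation_continuous_def by (intro order_tendstoD) auto
  then obtain N where N: "\<And>n. n \<ge> N \<Longrightarrow> (LINT x|lborel. \<bar>g (x - y n) - g x\<bar>) < e / 3"
    unfolding eventually_sequentially by auto
  show "\<exists>no. \<forall>n\<ge>no. norm ((LINT x|lborel. \<bar>f (x - y n) - f x\<bar>) - 0) < e"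
  proof (intro exI[of _ N] allI impI)
    fix n assume n: "n \<ge> N"
    have i1: "integrable lborel (\<lambda>x. \<bar>f x - g x\<bar>)" using f g by auto
    have i2: "integrable lborel (\<lambda>x. \<bar>f (x - y n) - g (x - y n)\<bar>)"
      using integrable_lborel_translate[OF i1] by simp
    have i3: "integrable lborel (\<lambda>x. \<bar>g (x - y n) - g x\<bar>)"
      using g integrable_lborel_translate[OF g(1), of "y n"] by auto
    have "(LINT x|lborel. \<bar>f (x - y n) - f x\<bar>) \<le>
        (LINT x|lborel. \<bar>f (x - y n) - g (x - y n)\<bar> + \<bar>g (x - y n) - g x\<bar> + \<bar>f x - g x\<bar>)"
      using i1 i2 i3 f integrable_lborel_translate[OF f, of "y n"] by (intro integral_mono) auto
    also have "\<dots> = (LINT x|lborel. \<bar>f (x - y n) - g (x - y n)\<bar>) + (LINT x|lborel. \<bar>g (x - y n) - g x\<bar>)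
        + (LINT x|lborel. \<bar>f x - g x\<bar>)"
      using i1 i2 i3 by simp
    also have "(LINT x|lborel. \<bar>f (x - y n) - g (x - y n)\<bar>) = (LINT x|lborel. \<bar>f x - g x\<bar>)"
      using integral_lborel_translate[of "\<lambda>x. \<bar>f x - g x\<bar>"] by simp
    finally have "(LINT x|lborel. \<bar>f (x - y n) - f x\<bar>) < e"
      using g(3) N[OF n] by linarith
    moreover have "(LINT x|lborel. \<bar>f (x - y n) - f x\<bar>) \<ge> 0"
      by simp
    ultimately show "norm ((LINT x|lborel. \<bar>f (x - y n) - f x\<bar>) - 0) < e" by simp
  qed
qed

text \<open>A point of an open set remains in it under small translations, so the part of \<open>U\<close> that is lost vanishes
in the limit; invariance of measure says that as much is gained as is lost.\<close>

lemma L1_translation_continuous_open: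
  fixes U :: "'a::euclidean_space set"
  assumes U: "open U" "emeasure lborel U < \<infinity>"
  shows "L1_translation_continuous (indicator U :: 'a \<Rightarrow> real)"
  unfolding L1_translation_continuous_def
proof (intro allI impI)
  fix y :: "nat \<Rightarrow> 'a"
  assume y: "y \<longlonglongrightarrow> 0"
  let ?u = "indicator U :: 'a \<Rightarrow> real"
  have [measurable]: "U \<in> sets borel" using U by auto
  have iu: "integrable lborel ?u" using U by (auto simp: integrable_indicator_iff)
  have iut: "integrable lborel (\<lambda>x. ?u (x - y n))" for n by (rule integrable_lborel_translate[OF iu])
  have eq: "(LINT x|lborel. \<bar>?u (x - y n) - ?u x\<bar>) = 2 * (LINT x|lborel. max 0 (?u x - ?u (x - y n)))" for n
  proof -
    have "(LINT x|lborel. \<bar>?u (x - y n) - ?u x\<bar>) = (LINT x|lborel. 2 * max 0 (?u x - ?u (x - y n)) + ?u (x - y n) - ?u x)"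
      by (intro Bochner_Integration.integral_cong) (auto simp: indicator_def)
    also have "\<dots> = 2 * (LINT x|lborel. max 0 (?u x - ?u (x - y n)))
        + (LINT x|lborel. ?u (x - y n)) - (LINT x|lborel. ?u x)"
      using iu iut[of n] by simp
    finally show ?thesis
      using integral_lborel_translate[of ?u "y n"] by simp
  qed
  have "(\<lambda>n. LINT x|lborel. max 0 (?u x - ?u (x - y n))) \<longlonglongrightarrow> (LINT x|(lborel :: 'a measure). (0::real))"
  proof (rule integral_dominated_convergence[where w = ?u])
    show "AE x in lborel. (\<lambda>n. max 0 (?u x - ?u (x - y n))) \<longlonglongrightarrow> 0"
    proof (rule AE_I2)
      fix x :: 'a
      show "(\<lambda>n. max 0 (?u x - ?u (x - y n))) \<longlonglongrightarrow> 0"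
      proof (cases "x \<in> U")
        case True
        have "(\<lambda>n. x - y n) \<longlonglongrightarrow> x - 0" by (intro tendsto_intros y)
        then have "\<forall>\<^sub>F n in sequentially. x - y n \<in> U"
          using U(1) True by (intro topological_tendstoD) auto
        then have "\<forall>\<^sub>F n in sequentially. max 0 (?u x - ?u (x - y n)) = 0"
          by eventually_elim auto
        then show ?thesis by (rule tendsto_eventually)
      qed auto
    qed
    show "AE x in lborel. norm (max 0 (?u x - ?u (x - y n))) \<le> ?u x" for n
      by (auto simp: indicator_def)
  qed (use iu in auto)
  then show "(\<lambda>n. LINT x|lborel. \<bar>?u (x - y n) - ?u x\<bar>) \<longlonglongrightarrow> 0"
    unfolding eq by (auto intro: tendsto_eq_intros)
qed

lemma L1_translation_continuous_integrable:
  fixes f :: "'a::euclidean_space \<Rightarrow> real"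
  assumes "integrable lborel f"
  shows "L1_translation_continuous f"
  using assms
proof (induction rule: integrable_induct)
  case (base A c)
  have [measurable]: "A \<in> sets borel" using base by auto
  have fin: "emeasure lborel A < \<infinity>" using base by auto
  have iA: "integrable lborel (indicator A :: 'a \<Rightarrow> real)" using fin by (auto simp: integrable_indicator_iff)
  have A: "L1_translation_continuous (indicator A :: 'a \<Rightarrow> real)"
  proof (rule L1_translation_continuous_closed[OF iA])
    fix e :: real assume e: "e > 0"
    have "A \<in> sets lebesgue" by auto
    then obtain U where U: "open U" "A \<subseteq> U" "emeasure lebesgue (U - A) < ennreal e"
      using e by (rule sets_lebesgue_outer_open)
    have [measurable]: "U \<in> sets borel" using U by auto
    have em: "emeasure lborel (U - A) < ennreal e" using U by simp
    have "emeasure lborel U \<le> emeasure lborel A + emeasure lborel (U - A)"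
      using U(2) emeasure_subadditive[of A lborel "U - A"] by (simp add: Un_absorb1)
    also have "\<dots> < \<infinity>" using fin em by (auto simp: less_top[symmetric])
    finally have finU: "emeasure lborel U < \<infinity>" .
    have "(LINT x|lborel. \<bar>indicator A x - indicator U x\<bar>) = (LINT x|lborel. indicator (U - A) x :: real)"
      using U(2) by (intro Bochner_Integration.integral_cong) (auto simp: indicator_def)
    also have "\<dots> = measure lborel (U - A)" by simp
    also have "\<dots> < e" using em e emeasure_eq_ennreal_measure[of lborel "U - A"]
      by (metis ennreal_less_iff ennreal_less_top measure_nonneg not_less_iff_gr_or_eq order_less_trans)
    finally show "\<exists>g. integrable lborel g \<and> L1_translation_continuous g \<and> (LINT x|lborel. \<bar>indicator A x - g x\<bar>) < e"
      using L1_translation_continuous_open[OF U(1) finU] finU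
      by (intro exI[of _ "indicator U :: 'a \<Rightarrow> real"]) (auto simp: integrable_indicator_iff)
  qed
  have "(LINT x|lborel. \<bar>indicator A (x - y n) *\<^sub>R c - indicator A x *\<^sub>R c\<bar>)
      = \<bar>c\<bar> * (LINT x|lborel. \<bar>indicator A (x - y n) - indicator A x\<bar>)" for y :: "nat \<Rightarrow> 'a" and n
    by (subst integral_mult_right_zero[symmetric])
      (simp add: abs_mult[symmetric] right_diff_distrib mult.commute)
  with A show ?case
    unfolding L1_translation_continuous_def by (auto intro: tendsto_mult_right_zero)
next
  case (add f g)
  show ?case unfolding L1_translation_continuous_def
  proof (intro allI impI)
    fix y :: "nat \<Rightarrow> 'a" assume y: "y \<longlonglongrightarrow> 0"
    have i: "integrable lborel (\<lambda>x. \<bar>f (x - y n) - f x\<bar>)" "integrable lborel (\<lambda>x. \<bar>g (x - y n) - g x\<bar>)" for n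
      using add.hyps integrable_lborel_translate[of f "y n"] integrable_lborel_translate[of g "y n"] by auto
    show "(\<lambda>n. LINT x|lborel. \<bar>f (x - y n) + g (x - y n) - (f x + g x)\<bar>) \<longlonglongrightarrow> 0"
    proof (rule tendsto_sandwich[where f = "\<lambda>_. 0"])
      show "(\<lambda>n. (LINT x|lborel. \<bar>f (x - y n) - f x\<bar>) + (LINT x|lborel. \<bar>g (x - y n) - g x\<bar>)) \<longlonglongrightarrow> 0"
        using add.IH y unfolding L1_translation_continuous_def by (auto intro: tendsto_eq_intros)
      show "\<forall>\<^sub>F n in sequentially. (LINT x|lborel. \<bar>f (x - y n) + g (x - y n) - (f x + g x)\<bar>)
         \<le> (LINT x|lborel. \<bar>f (x - y n) - f x\<bar>) + (LINT x|lborel. \<bar>g (x - y n) - g x\<bar>)"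
        unfolding Bochner_Integration.integral_add[OF i, symmetric]
        using i add.hyps integrable_lborel_translate[of f "y n" for n] integrable_lborel_translate[of g "y n" for n]
        by (intro always_eventually allI integral_mono) auto
    qed auto
  qed
next
  case (lim f s)
  have [measurable]: "f \<in> borel_measurable borel" "\<And>i. s i \<in> borel_measurable borel" using lim by auto
  have "(\<lambda>i. LINT x|lborel. \<bar>f x - s i x\<bar>) \<longlonglongrightarrow> (LINT x|(lborel :: 'a measure). (0::real))"
  proof (rule integral_dominated_convergence[where w = "\<lambda>x. 3 * \<bar>f x\<bar>"])
    have "(\<lambda>i. \<bar>f x - s i x\<bar>) \<longlonglongrightarrow> \<bar>f x - f x\<bar>" for x
      using lim by (intro tendsto_intros) auto
    then show "AE x in lborel. (\<lambda>i. \<bar>f x - s i x\<bar>) \<longlonglongrightarrow> 0" by simp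
    show "AE x in lborel. norm \<bar>f x - s i x\<bar> \<le> 3 * \<bar>f x\<bar>" for i
    proof (rule AE_I2)
      fix x show "norm \<bar>f x - s i x\<bar> \<le> 3 * \<bar>f x\<bar>"
        using lim.hyps(3)[of x i] by auto
    qed
  qed (use lim in auto)
  then have l: "(\<lambda>i. LINT x|lborel. \<bar>f x - s i x\<bar>) \<longlonglongrightarrow> 0" by simp
  show ?case
  proof (rule L1_translation_continuous_closed)
    fix e :: real assume "e > 0"
    with l have "\<forall>\<^sub>F i in sequentially. (LINT x|lborel. \<bar>f x - s i x\<bar>) < e"
      by (intro order_tendstoD) auto
    then obtain i where "(LINT x|lborel. \<bar>f x - s i x\<bar>) < e"
      by (auto simp: eventually_sequentially)
    then show "\<exists>g. integrable lborel g \<and> L1_translation_continuous g \<and> (LINT x|lborel. \<bar>f x - g x\<bar>) < e"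
      using lim.hyps(1) lim.IH by blast
  qed (use lim in auto)
qed

text \<open>For \<open>a, b \<ge> 0\<close> we have \<open>(a - b)\<^sup>2 \<le> |a\<^sup>2 - b\<^sup>2|\<close>, which reduces the claim to \<open>L\<^sup>1\<close>-continuity of the
translations of \<open>f\<^sup>2\<close>. Splitting into positive and negative parts, and into real and imaginary parts,
then removes the sign condition.\<close>

lemma L2_translation_nonneg:
  fixes f :: "'a::euclidean_space \<Rightarrow> real"
  assumes [measurable]: "f \<in> borel_measurable borel" and i: "integrable lborel (\<lambda>x. (f x)\<^sup>2)"
    and nn: "\<And>x. f x \<ge> 0" and y: "y \<longlonglongrightarrow> 0"
  shows "(\<lambda>n. LINT x|lborel. (f (x - y n) - f x)\<^sup>2) \<longlonglongrightarrow> 0"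
proof (rule tendsto_sandwich[where f = "\<lambda>_. 0"])
  show "(\<lambda>n. LINT x|lborel. \<bar>(f (x - y n))\<^sup>2 - (f x)\<^sup>2\<bar>) \<longlonglongrightarrow> 0"
    using L1_translation_continuous_integrable[OF i] y unfolding L1_translation_continuous_def by auto
  have ii: "integrable lborel (\<lambda>x. \<bar>(f (x - y n))\<^sup>2 - (f x)\<^sup>2\<bar>)" for n
    using i integrable_lborel_translate[OF i, of "y n"] by auto
  have le: "(f (x - y n) - f x)\<^sup>2 \<le> \<bar>(f (x - y n))\<^sup>2 - (f x)\<^sup>2\<bar>" for x n
  proof -
    have "(f (x - y n) - f x)\<^sup>2 = \<bar>f (x - y n) - f x\<bar> * \<bar>f (x - y n) - f x\<bar>"
      by (simp add: power2_eq_square)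
    also have "\<dots> \<le> \<bar>f (x - y n) - f x\<bar> * \<bar>f (x - y n) + f x\<bar>"
      using nn[of x] nn[of "x - y n"] by (intro mult_left_mono) auto
    also have "\<dots> = \<bar>(f (x - y n))\<^sup>2 - (f x)\<^sup>2\<bar>"
      by (simp add: abs_mult[symmetric] power2_eq_square algebra_simps)
    finally show ?thesis .
  qed
  show "\<forall>\<^sub>F n in sequentially. (LINT x|lborel. (f (x - y n) - f x)\<^sup>2) \<le> (LINT x|lborel. \<bar>(f (x - y n))\<^sup>2 - (f x)\<^sup>2\<bar>)"
    using ii le by (intro always_eventually allI integral_mono' ) auto
qed auto

lemma integrable_square_translate_diff:
  fixes f :: "'a::euclidean_space \<Rightarrow> real"
  assumes [measurable]: "f \<in> borel_measurable borel" and i: "integrable lborel (\<lambda>x. (f x)\<^sup>2)"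
  shows "integrable lborel (\<lambda>x. (f (x - y) - f x)\<^sup>2)"
proof (rule Bochner_Integration.integrable_bound)
  show "integrable lborel (\<lambda>x. 2 * (f (x - y))\<^sup>2 + 2 * (f x)\<^sup>2)"
    using i integrable_lborel_translate[OF i, of y] by auto
  have "(a - b)\<^sup>2 \<le> 2 * a\<^sup>2 + 2 * b\<^sup>2" for a b :: real
    using zero_le_power2[of "a + b"] by (simp add: power2_eq_square algebra_simps)
  then show "AE x in lborel. norm ((f (x - y) - f x)\<^sup>2) \<le> norm (2 * (f (x - y))\<^sup>2 + 2 * (f x)\<^sup>2)"
    by auto
qed auto

lemma L2_translation_real:
  fixes f :: "'a::euclidean_space \<Rightarrow> real"
  assumes [measurable]: "f \<in> borel_measurable borel" and i: "integrable lborel (\<lambda>x. (f x)\<^sup>2)"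
    and y: "y \<longlonglongrightarrow> 0"
  shows "(\<lambda>n. LINT x|lborel. (f (x - y n) - f x)\<^sup>2) \<longlonglongrightarrow> 0"
proof -
  define p where "p x = max 0 (f x)" for x
  define m where "m x = max 0 (- f x)" for x
  have [measurable]: "p \<in> borel_measurable borel" "m \<in> borel_measurable borel"
    unfolding p_def m_def by measurable
  have fpm: "f x = p x - m x" for x by (auto simp: p_def m_def)
  have ip: "integrable lborel (\<lambda>x. (p x)\<^sup>2)" "integrable lborel (\<lambda>x. (m x)\<^sup>2)"
    by (rule Bochner_Integration.integrable_bound[OF i]; auto simp: p_def m_def max_def)+
  note d = integrable_square_translate_diff[OF _ ip(1)] integrable_square_translate_diff[OF _ ip(2)]
  show ?thesis
  proof (rule tendsto_sandwich[where f = "\<lambda>_. 0"])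
    show "(\<lambda>n. 2 * (LINT x|lborel. (p (x - y n) - p x)\<^sup>2) + 2 * (LINT x|lborel. (m (x - y n) - m x)\<^sup>2)) \<longlonglongrightarrow> 0"
      using L2_translation_nonneg[OF _ ip(1) _ y] L2_translation_nonneg[OF _ ip(2) _ y]
      by (auto intro!: tendsto_eq_intros simp: p_def m_def)
    have "(a - b)\<^sup>2 \<le> 2 * a\<^sup>2 + 2 * b\<^sup>2" for a b :: real
      using zero_le_power2[of "a + b"] by (simp add: power2_eq_square algebra_simps)
    from this[of "p (x - y n) - p x" "m (x - y n) - m x" for x n]
    have le: "(f (x - y n) - f x)\<^sup>2 \<le> 2 * (p (x - y n) - p x)\<^sup>2 + 2 * (m (x - y n) - m x)\<^sup>2" for x n
      by (simp add: fpm algebra_simps)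
    have "(LINT x|lborel. (f (x - y n) - f x)\<^sup>2) \<le>
        (LINT x|lborel. 2 * (p (x - y n) - p x)\<^sup>2 + 2 * (m (x - y n) - m x)\<^sup>2)" for n
      using d le by (intro integral_mono') auto
    then show "\<forall>\<^sub>F n in sequentially. (LINT x|lborel. (f (x - y n) - f x)\<^sup>2)
      \<le> 2 * (LINT x|lborel. (p (x - y n) - p x)\<^sup>2) + 2 * (LINT x|lborel. (m (x - y n) - m x)\<^sup>2)"
      using d by simp
  qed auto
qed

lemma L2_translation_complex:
  fixes g :: "'a::euclidean_space \<Rightarrow> complex"
  assumes [measurable]: "g \<in> borel_measurable borel" and i: "integrable lborel (\<lambda>x. (norm (g x))\<^sup>2)"
    and y: "y \<longlonglongrightarrow> 0"
  shows "(\<lambda>n. LINT x|lborel. (norm (g (x - y n) - g x))\<^sup>2) \<longlonglongrightarrow> 0"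
proof -
  have ip: "integrable lborel (\<lambda>x. (Re (g x))\<^sup>2)" "integrable lborel (\<lambda>x. (Im (g x))\<^sup>2)"
    by (rule Bochner_Integration.integrable_bound[OF i]; auto simp: cmod_power2)+
  note d = integrable_square_translate_diff[OF _ ip(1)] integrable_square_translate_diff[OF _ ip(2)]
  have "(LINT x|lborel. (norm (g (x - y n) - g x))\<^sup>2) =
     (LINT x|lborel. (Re (g (x - y n)) - Re (g x))\<^sup>2) + (LINT x|lborel. (Im (g (x - y n)) - Im (g x))\<^sup>2)" for n
    using d by (simp add: cmod_power2)
  then show ?thesis
    using L2_translation_real[OF _ ip(1) y] L2_translation_real[OF _ ip(2) y]
    by (auto intro!: tendsto_eq_intros)
qed

section \<open>Fourier transform and Plancherel's theorem in the plane\<close>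

lemma fst_borel_measurable [measurable]:
    "(fst :: 'a::second_countable_topology \<times> 'b::second_countable_topology \<Rightarrow> 'a) \<in> borel_measurable borel"
  and snd_borel_measurable [measurable]:
    "(snd :: 'a::second_countable_topology \<times> 'b::second_countable_topology \<Rightarrow> 'b) \<in> borel_measurable borel"
  by (intro borel_measurable_continuous_onI continuous_intros)+

lemma cis_measurable [measurable]: "cis \<in> borel_measurable borel"
  by (intro borel_measurable_continuous_onI continuous_intros)

lemma
  fixes h1 :: "'a::euclidean_space \<Rightarrow> 'c::{real_normed_field, banach, second_countable_topology}"
    and h2 :: "'b::euclidean_space \<Rightarrow> 'c"
  assumes i: "integrable lborel h1" "integrable lborel h2"
  shows integrable_lborel_prod_mult: "integrable lborel (\<lambda>p. h1 (fst p) * h2 (snd p))"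
    and integral_lborel_prod_mult:
      "(LINT p|lborel. h1 (fst p) * h2 (snd p)) = (LINT x|lborel. h1 x) * (LINT y|lborel. h2 y)"
proof -
  have [measurable]: "h1 \<in> borel_measurable borel" "h2 \<in> borel_measurable borel" using i by auto
  have *: "integrable (lborel \<Otimes>\<^sub>M lborel) (\<lambda>(x, y). h1 x * h2 y)"
    using i by (intro lborel_pair.Fubini_integrable) (auto simp: norm_mult)
  then show "integrable lborel (\<lambda>p. h1 (fst p) * h2 (snd p))"
    by (simp add: lborel_prod case_prod_beta')
  have "(LINT p|lborel. h1 (fst p) * h2 (snd p)) = (LINT p|(lborel \<Otimes>\<^sub>M lborel). (\<lambda>(x, y). h1 x * h2 y) p)"
    by (simp add: lborel_prod case_prod_beta')
  also have "\<dots> = (LINT x|lborel. LINT y|lborel. h1 x * h2 y)"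
    using lborel_pair.integral_fst'[OF *] by simp
  finally show "(LINT p|lborel. h1 (fst p) * h2 (snd p)) = (LINT x|lborel. h1 x) * (LINT y|lborel. h2 y)"
    by simp
qed

lemma
  fixes t :: real
  shows integrable_gaussian_real: "integrable lborel (\<lambda>x. exp (- x\<^sup>2 / 2) :: real)"
    and fourier_gaussian_real: "(LINT x|lborel. cis (t * x) * complex_of_real (exp (- x\<^sup>2 / 2)))
         = complex_of_real (sqrt (2 * pi) * exp (- t\<^sup>2 / 2))"
proof -
  have s: "exp (- x\<^sup>2 / 2) = sqrt (2 * pi) * std_normal_density x" for x :: real
    by (simp add: std_normal_density_def real_sqrt_mult)
  show "integrable lborel (\<lambda>x. exp (- x\<^sup>2 / 2) :: real)"
    unfolding s by simp
  have "complex_of_real (exp (- t\<^sup>2 / 2)) = (LINT x|density lborel std_normal_density. iexp (t * x))"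
    using fun_cong[OF char_std_normal_distribution, of t] by (simp add: char_def)
  also have "\<dots> = (LINT x|lborel. std_normal_density x *\<^sub>R iexp (t * x))"
    by (subst integral_density) (auto simp: normal_density_nonneg)
  finally have *: "complex_of_real (exp (- t\<^sup>2 / 2)) = (LINT x|lborel. std_normal_density x *\<^sub>R iexp (t * x))" .
  have "(LINT x|lborel. cis (t * x) * complex_of_real (exp (- x\<^sup>2 / 2))) =
     (LINT x|lborel. complex_of_real (sqrt (2 * pi)) * (std_normal_density x *\<^sub>R iexp (t * x)))"
    unfolding s by (intro Bochner_Integration.integral_cong) (auto simp: cis_conv_exp scaleR_conv_of_real)
  also have "\<dots> = complex_of_real (sqrt (2 * pi)) * complex_of_real (exp (- t\<^sup>2 / 2))"
    by (simp only: * integral_mult_right_zero)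
  finally show "(LINT x|lborel. cis (t * x) * complex_of_real (exp (- x\<^sup>2 / 2)))
         = complex_of_real (sqrt (2 * pi) * exp (- t\<^sup>2 / 2))" by simp
qed

definition gaussian :: "real \<times> real \<Rightarrow> real" where
  "gaussian \<xi> = exp (- (norm \<xi>)\<^sup>2 / 2)"

lemma gaussian_measurable [measurable]: "gaussian \<in> borel_measurable borel"
  unfolding gaussian_def by measurable

lemma gaussian_pos: "gaussian \<xi> > 0"
  by (simp add: gaussian_def)

lemma gaussian_eq: "gaussian \<xi> = exp (- (fst \<xi>)\<^sup>2 / 2) * exp (- (snd \<xi>)\<^sup>2 / 2)"
  by (cases \<xi>) (simp add: gaussian_def norm_Pair exp_add[symmetric] add_divide_distrib)

lemma integrable_gaussian: "integrable lborel gaussian"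
  using integrable_lborel_prod_mult[OF integrable_gaussian_real integrable_gaussian_real]
  by (simp add: gaussian_eq[abs_def])

lemma fourier_gaussian:
  "(LINT \<xi>|lborel. cis (- (v \<bullet> \<xi>)) * complex_of_real (gaussian \<xi>)) = complex_of_real (2 * pi * gaussian v)"
proof -
  have i: "integrable lborel (\<lambda>x. cis (t * x) * complex_of_real (exp (- x\<^sup>2 / 2)))" for t
    by (rule Bochner_Integration.integrable_bound[OF integrable_gaussian_real]) (auto simp: norm_mult)
  have "cis (- (v \<bullet> \<xi>)) = cis (- fst v * fst \<xi>) * cis (- snd v * snd \<xi>)" for \<xi>
    by (simp add: cis_mult inner_prod_def)
  then have "cis (- (v \<bullet> \<xi>)) * complex_of_real (gaussian \<xi>) =
     (cis (- fst v * fst \<xi>) * complex_of_real (exp (- (fst \<xi>)\<^sup>2 / 2))) *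
     (cis (- snd v * snd \<xi>) * complex_of_real (exp (- (snd \<xi>)\<^sup>2 / 2)))" for \<xi>
    by (simp only: gaussian_eq of_real_mult mult_ac)
  then have "(LINT \<xi>|lborel. cis (- (v \<bullet> \<xi>)) * complex_of_real (gaussian \<xi>)) =
     complex_of_real (sqrt (2 * pi) * exp (- (fst v)\<^sup>2 / 2)) * complex_of_real (sqrt (2 * pi) * exp (- (snd v)\<^sup>2 / 2))"
    using integral_lborel_prod_mult[OF i i, of "- fst v" "- snd v"]
      fourier_gaussian_real[of "- fst v"] fourier_gaussian_real[of "- snd v"] by simp
  also have "\<dots> = complex_of_real ((sqrt (2 * pi) * sqrt (2 * pi)) * gaussian v)"
    by (simp only: gaussian_eq of_real_mult mult_ac)
  finally show ?thesis by simp
qed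

lemma integral_gaussian: "(LINT \<xi>|lborel. gaussian \<xi>) = 2 * pi"
proof -
  have "complex_of_real (LINT \<xi>|lborel. gaussian \<xi>) = complex_of_real (2 * pi)"
    using fourier_gaussian[of 0] by (simp add: gaussian_def)
  then show ?thesis by (simp only: of_real_eq_iff)
qed

lemma integrable_gaussian_scaled: "e \<noteq> 0 \<Longrightarrow> integrable lborel (\<lambda>\<xi>. gaussian (e *\<^sub>R \<xi>))"
  using integrable_lborel_affine[OF integrable_gaussian, of e 0] by simp

lemma fourier_gaussian_scaled:
  assumes e: "e > 0"
  shows "(LINT \<xi>|lborel. cis (- (v \<bullet> \<xi>)) * complex_of_real (gaussian (e *\<^sub>R \<xi>)))
     = complex_of_real (2 * pi / e\<^sup>2 * gaussian (v /\<^sub>R e))"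
proof -
  have "(LINT \<xi>|lborel. cis (- (v \<bullet> \<xi>)) * complex_of_real (gaussian (e *\<^sub>R \<xi>)))
     = (1 / e\<^sup>2) *\<^sub>R (LINT \<xi>|lborel. cis (- ((v /\<^sub>R e) \<bullet> \<xi>)) * complex_of_real (gaussian \<xi>))"
    using e by (subst integral_lborel_affine[where c = "1/e" and t = 0])
      (auto simp: power_divide divide_inverse mult.commute power2_eq_square)
  then show ?thesis
    unfolding fourier_gaussian by (simp add: scaleR_conv_of_real)
qed

text \<open>The normalisation without a prefactor makes \<open>(2 \<pi>)\<^sup>2\<close> appear in Plancherel's theorem in the plane.\<close>

definition fourier :: "('a::euclidean_space \<Rightarrow> complex) \<Rightarrow> 'a \<Rightarrow> complex" where
  "fourier g \<xi> = (LINT x|lborel. cis (- (x \<bullet> \<xi>)) * g x)"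

lemma fourier_measurable [measurable]:
  assumes [measurable]: "g \<in> borel_measurable borel"
  shows "fourier g \<in> borel_measurable borel"
  unfolding fourier_def by measurable

lemma integrable_cis_mult:
  assumes "integrable M g" and [measurable]: "h \<in> borel_measurable M"
  shows "integrable M (\<lambda>x. cis (h x) * g x)"
  by (rule Bochner_Integration.integrable_bound[OF assms(1)]) (use assms in \<open>auto simp: norm_mult\<close>)

lemma norm_fourier_le:
  assumes "integrable lborel g"
  shows "norm (fourier g \<xi>) \<le> (LINT x|lborel. norm (g x))"
proof -
  have "norm (fourier g \<xi>) \<le> (LINT x|lborel. norm (cis (- (x \<bullet> \<xi>)) * g x))"
    unfolding fourier_def by (rule integral_norm_bound)
  then show ?thesis by (simp add: norm_mult)
qed

text \<open>The Gaussian weight makes the triple integral over \<open>x\<close>, \<open>y\<close>, \<open>\<xi>\<close> absolutely convergent for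
\<open>g \<in> L\<^sup>1\<close>, so Fubini applies and the \<open>\<xi>\<close>-integral can be evaluated as the Fourier transform of a Gaussian.\<close>

lemma weighted_energy_fourier:
  fixes g :: "real \<times> real \<Rightarrow> complex"
  assumes g: "integrable lborel g" and e: "e > 0"
  shows "(LINT \<xi>|lborel. (norm (fourier g \<xi>))\<^sup>2 * gaussian (e *\<^sub>R \<xi>)) =
    (LINT x|lborel. LINT y|lborel. Re (g x * cnj (g y)) * (2 * pi / e\<^sup>2 * gaussian ((x - y) /\<^sub>R e)))"
proof -
  have [measurable]: "g \<in> borel_measurable borel" using g by auto
  have ig: "integrable lborel (\<lambda>p. g (fst p) * cnj (g (snd p)))"
    using integrable_lborel_prod_mult[OF g, of "\<lambda>x. cnj (g x)"] g by simp
  let ?K = "\<lambda>(p, \<xi>). cis (- ((fst p - snd p) \<bullet> \<xi>)) * ((g (fst p) * cnj (g (snd p))) * complex_of_real (gaussian (e *\<^sub>R \<xi>)))"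
  have "integrable lborel (\<lambda>q. (g (fst (fst q)) * cnj (g (snd (fst q)))) * complex_of_real (gaussian (e *\<^sub>R snd q)))"
    using integrable_lborel_prod_mult[OF ig, of "\<lambda>\<xi>. complex_of_real (gaussian (e *\<^sub>R \<xi>))"]
      integrable_gaussian_scaled[of e] e by simp
  from integrable_cis_mult[OF this, of "\<lambda>q. - ((fst (fst q) - snd (fst q)) \<bullet> snd q)"]
  have iK: "integrable (lborel \<Otimes>\<^sub>M lborel) ?K"
    by (simp add: lborel_prod case_prod_beta')
  have sq: "complex_of_real ((norm (fourier g \<xi>))\<^sup>2) =
      (LINT p|lborel. cis (- ((fst p - snd p) \<bullet> \<xi>)) * (g (fst p) * cnj (g (snd p))))" for \<xi>
  proof -
    have "complex_of_real ((norm (fourier g \<xi>))\<^sup>2) = fourier g \<xi> * cnj (fourier g \<xi>)"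
      by (rule complex_norm_square)
    also have "cnj (fourier g \<xi>) = (LINT x|lborel. cnj (cis (- (x \<bullet> \<xi>)) * g x))"
      unfolding fourier_def by (rule Bochner_Integration.integral_cnj[symmetric])
    also have "fourier g \<xi> * (LINT x|lborel. cnj (cis (- (x \<bullet> \<xi>)) * g x)) =
       (LINT p|lborel. (cis (- (fst p \<bullet> \<xi>)) * g (fst p)) * cnj (cis (- (snd p \<bullet> \<xi>)) * g (snd p)))"
      unfolding fourier_def
      by (rule integral_lborel_prod_mult[symmetric])
         (use integrable_cis_mult[OF g, of "\<lambda>x. - (x \<bullet> \<xi>)"] in \<open>auto simp del: complex_cnj_mult\<close>)
    also have "\<dots> = (LINT p|lborel. cis (- ((fst p - snd p) \<bullet> \<xi>)) * (g (fst p) * cnj (g (snd p))))"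
    proof (intro Bochner_Integration.integral_cong refl)
      fix p :: "(real \<times> real) \<times> (real \<times> real)"
      have "cis (- ((fst p - snd p) \<bullet> \<xi>)) = cis (- (fst p \<bullet> \<xi>)) * cnj (cis (- (snd p \<bullet> \<xi>)))"
        by (simp add: cis_cnj cis_mult inner_diff_left)
      then show "(cis (- (fst p \<bullet> \<xi>)) * g (fst p)) * cnj (cis (- (snd p \<bullet> \<xi>)) * g (snd p)) =
         cis (- ((fst p - snd p) \<bullet> \<xi>)) * (g (fst p) * cnj (g (snd p)))" by simp
    qed
    finally show ?thesis .
  qed
  have inner: "(LINT \<xi>|lborel. ?K (p, \<xi>)) =
     g (fst p) * cnj (g (snd p)) * complex_of_real (2 * pi / e\<^sup>2 * gaussian ((fst p - snd p) /\<^sub>R e))" for p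
    using fourier_gaussian_scaled[OF e, of "fst p - snd p"]
    by (simp add: mult.left_commute[of "cis _"])
  have "complex_of_real (LINT \<xi>|lborel. (norm (fourier g \<xi>))\<^sup>2 * gaussian (e *\<^sub>R \<xi>))
     = (LINT \<xi>|lborel. complex_of_real ((norm (fourier g \<xi>))\<^sup>2) * complex_of_real (gaussian (e *\<^sub>R \<xi>)))"
    by (simp flip: integral_complex_of_real)
  also have "\<dots> = (LINT \<xi>|lborel. LINT p|lborel. ?K (p, \<xi>))"
    unfolding sq by (simp add: mult.assoc flip: integral_mult_left_zero)
  also have "\<dots> = (LINT p|lborel. LINT \<xi>|lborel. ?K (p, \<xi>))"
    using lborel_pair.Fubini_integral[of "\<lambda>p \<xi>. ?K (p, \<xi>)"] iK by simp
  finally have eq: "complex_of_real (LINT \<xi>|lborel. (norm (fourier g \<xi>))\<^sup>2 * gaussian (e *\<^sub>R \<xi>)) =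
     (LINT p|lborel. LINT \<xi>|lborel. ?K (p, \<xi>))" .
  have ip: "integrable lborel (\<lambda>p. LINT \<xi>|lborel. ?K (p, \<xi>))"
    using lborel_pair.integrable_fst'[OF iK] by simp
  have "(LINT \<xi>|lborel. (norm (fourier g \<xi>))\<^sup>2 * gaussian (e *\<^sub>R \<xi>)) = Re (LINT p|lborel. LINT \<xi>|lborel. ?K (p, \<xi>))"
    using arg_cong[OF eq, of Re] by simp
  also have "\<dots> = (LINT p|lborel. Re (LINT \<xi>|lborel. ?K (p, \<xi>)))"
    using ip by simp
  also have "\<dots> = (LINT p|(lborel \<Otimes>\<^sub>M lborel). Re (LINT \<xi>|lborel. ?K (p, \<xi>)))"
    by (simp only: lborel_prod)
  also have "\<dots> = (LINT x|lborel. LINT y|lborel. Re (LINT \<xi>|lborel. ?K ((x, y), \<xi>)))"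
    using lborel_pair.integral_fst'[of "\<lambda>p. Re (LINT \<xi>|lborel. ?K (p, \<xi>))"] ip
    by (simp add: lborel_prod)
  finally show ?thesis
    unfolding inner by simp
qed

lemma cnj_measurable [measurable]: "cnj \<in> borel_measurable borel"
  by (intro borel_measurable_continuous_onI continuous_intros)

lemma Re_mult_cnj_polarization:
  "Re (a * cnj b) = ((norm a)\<^sup>2 + (norm b)\<^sup>2 - (norm (b - a))\<^sup>2) / 2"
  unfolding cmod_power2 by (simp add: power2_eq_square algebra_simps)

lemma norm_diff_square_le: "(norm (b - c))\<^sup>2 \<le> 2 * (norm b)\<^sup>2 + 2 * (norm c)\<^sup>2" for b c :: complex
  using zero_le_power2[of "Re b + Re c"] zero_le_power2[of "Im b + Im c"]
  unfolding cmod_power2 by (simp add: power2_eq_square algebra_simps)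

text \<open>Substituting \<open>y = x - e z\<close> and polarising expresses the weighted energy by the \<open>L\<^sup>2\<close>-distances between
\<open>g\<close> and its translates, which vanish as \<open>e \<rightarrow> 0\<close>.\<close>

lemma weighted_energy_fourier_correlation:
  fixes g :: "real \<times> real \<Rightarrow> complex"
  assumes g: "integrable lborel g" and g2: "integrable lborel (\<lambda>x. (norm (g x))\<^sup>2)" and e: "e > 0"
  defines "S \<equiv> LINT x|lborel. (norm (g x))\<^sup>2"
  shows "(LINT \<xi>|lborel. (norm (fourier g \<xi>))\<^sup>2 * gaussian (e *\<^sub>R \<xi>)) =
    2 * pi * (LINT z|lborel. gaussian z * (S - (LINT x|lborel. (norm (g (x - e *\<^sub>R z) - g x))\<^sup>2) / 2))"
proof -
  have [measurable]: "g \<in> borel_measurable borel" using g by auto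
  have g2t: "integrable lborel (\<lambda>x. (norm (g (x - a)))\<^sup>2)" for a
    using integrable_lborel_translate[OF g2] .
  have S: "(LINT x|lborel. (norm (g (x - a)))\<^sup>2) = S" for a
    unfolding S_def by (rule integral_lborel_translate) measurable
  have re_le: "\<bar>Re (a * cnj b)\<bar> \<le> (norm a)\<^sup>2 + (norm b)\<^sup>2" for a b
  proof -
    have "\<bar>Re (a * cnj b)\<bar> \<le> norm a * norm b"
      using abs_Re_le_cmod[of "a * cnj b"] by (simp add: norm_mult)
    also have "\<dots> \<le> (norm a)\<^sup>2 + (norm b)\<^sup>2"
    proof -
      have "0 \<le> norm a * norm b" by simp
      then show ?thesis using sum_squares_bound[of "norm a" "norm b"] by linarith
    qed
    finally show ?thesis .
  qed
  have id: "integrable lborel (\<lambda>x. (norm (g (x - a) - g x))\<^sup>2)" for a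
  proof (rule Bochner_Integration.integrable_bound)
    show "integrable lborel (\<lambda>x. 2 * (norm (g (x - a)))\<^sup>2 + 2 * (norm (g x))\<^sup>2)"
      using g2 g2t by auto
    show "AE x in lborel. norm ((norm (g (x - a) - g x))\<^sup>2) \<le> norm (2 * (norm (g (x - a)))\<^sup>2 + 2 * (norm (g x))\<^sup>2)"
      using norm_diff_square_le by auto
  qed measurable
  let ?H = "\<lambda>(z, x). gaussian z * Re (g x * cnj (g (x - e *\<^sub>R z)))"
  have i1: "integrable (lborel \<Otimes>\<^sub>M lborel) (\<lambda>(z, x). gaussian z * (norm (g x))\<^sup>2)"
    using integrable_lborel_prod_mult[OF integrable_gaussian g2] by (simp add: lborel_prod case_prod_beta')
  have i2: "integrable (lborel \<Otimes>\<^sub>M lborel) (\<lambda>(z, x). gaussian z * (norm (g (x - e *\<^sub>R z)))\<^sup>2)"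
  proof (rule lborel_pair.Fubini_integrable)
    show "AE z in lborel. integrable lborel (\<lambda>x. case (z, x) of (z, x) \<Rightarrow> gaussian z * (norm (g (x - e *\<^sub>R z)))\<^sup>2)"
      using g2t by auto
    have "(LINT x|lborel. norm (gaussian z * (norm (g (x - e *\<^sub>R z)))\<^sup>2)) = gaussian z * S" for z
      using S[of "e *\<^sub>R z"] gaussian_pos[of z] by (simp add: abs_mult)
    then show "integrable lborel (\<lambda>z. LINT x|lborel. norm (case (z, x) of (z, x) \<Rightarrow> gaussian z * (norm (g (x - e *\<^sub>R z)))\<^sup>2))"
      using integrable_gaussian by simp
  qed measurable
  have iH: "integrable (lborel \<Otimes>\<^sub>M lborel) ?H"
  proof (rule Bochner_Integration.integrable_bound)
    show "integrable (lborel \<Otimes>\<^sub>M lborel) (\<lambda>q. (case q of (z, x) \<Rightarrow> gaussian z * (norm (g x))\<^sup>2) +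
       (case q of (z, x) \<Rightarrow> gaussian z * (norm (g (x - e *\<^sub>R z)))\<^sup>2))"
      by (intro Bochner_Integration.integrable_add i1 i2)
    have "norm (?H q) \<le> norm ((case q of (z, x) \<Rightarrow> gaussian z * (norm (g x))\<^sup>2) +
       (case q of (z, x) \<Rightarrow> gaussian z * (norm (g (x - e *\<^sub>R z)))\<^sup>2))" for q
    proof -
      obtain z x where q: "q = (z, x)" by (rule prod.exhaust)
      have "norm (gaussian z * Re (g x * cnj (g (x - e *\<^sub>R z))))
          = gaussian z * \<bar>Re (g x * cnj (g (x - e *\<^sub>R z)))\<bar>"
        unfolding real_norm_def abs_mult using gaussian_pos[of z] by simp
      also have "\<dots> \<le> gaussian z * ((norm (g x))\<^sup>2 + (norm (g (x - e *\<^sub>R z)))\<^sup>2)"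
        by (intro mult_left_mono re_le less_imp_le gaussian_pos)
      finally show ?thesis
        unfolding q prod.case by (simp add: distrib_left)
    qed
    then show "AE q in lborel \<Otimes>\<^sub>M lborel. norm (?H q) \<le> norm ((case q of (z, x) \<Rightarrow> gaussian z * (norm (g x))\<^sup>2) +
       (case q of (z, x) \<Rightarrow> gaussian z * (norm (g (x - e *\<^sub>R z)))\<^sup>2))"
      by (intro AE_I2)
  qed measurable
  have "(LINT \<xi>|lborel. (norm (fourier g \<xi>))\<^sup>2 * gaussian (e *\<^sub>R \<xi>)) =
    (LINT x|lborel. LINT y|lborel. Re (g x * cnj (g y)) * (2 * pi / e\<^sup>2 * gaussian ((x - y) /\<^sub>R e)))"
    by (rule weighted_energy_fourier[OF g e])
  also have "\<dots> = (LINT x|lborel. 2 * pi * (LINT z|lborel. ?H (z, x)))"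
  proof (intro Bochner_Integration.integral_cong refl)
    fix x
    have D: "\<bar>- e\<bar> ^ DIM(real \<times> real) = e\<^sup>2" by (simp add: power2_eq_square)
    have "(LINT y|lborel. Re (g x * cnj (g y)) * (2 * pi / e\<^sup>2 * gaussian ((x - y) /\<^sub>R e))) =
       e\<^sup>2 *\<^sub>R (LINT z|lborel. Re (g x * cnj (g (x + (- e) *\<^sub>R z))) * (2 * pi / e\<^sup>2 * gaussian ((x - (x + (- e) *\<^sub>R z)) /\<^sub>R e)))"
      unfolding D[symmetric] by (rule integral_lborel_affine) (use e in \<open>measurable, auto\<close>)
    also have "\<dots> = (LINT z|lborel. e\<^sup>2 * (Re (g x * cnj (g (x + (- e) *\<^sub>R z))) * (2 * pi / e\<^sup>2 * gaussian ((x - (x + (- e) *\<^sub>R z)) /\<^sub>R e))))"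
      by (simp only: real_scaleR_def integral_mult_right_zero)
    also have "\<dots> = (LINT z|lborel. 2 * pi * ?H (z, x))"
      using e by (intro Bochner_Integration.integral_cong refl) (simp add: field_simps)
    finally show "(LINT y|lborel. Re (g x * cnj (g y)) * (2 * pi / e\<^sup>2 * gaussian ((x - y) /\<^sub>R e))) =
       2 * pi * (LINT z|lborel. ?H (z, x))" by simp
  qed
  also have "\<dots> = 2 * pi * (LINT x|lborel. LINT z|lborel. ?H (z, x))"
    by simp
  also have "(LINT x|lborel. LINT z|lborel. ?H (z, x)) = (LINT z|lborel. LINT x|lborel. ?H (z, x))"
    using lborel_pair.Fubini_integral[of "\<lambda>z x. ?H (z, x)"] iH by simp
  also have "\<dots> = (LINT z|lborel. gaussian z * (S - (LINT x|lborel. (norm (g (x - e *\<^sub>R z) - g x))\<^sup>2) / 2))"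
  proof (intro Bochner_Integration.integral_cong refl)
    fix z
    have "(LINT x|lborel. ?H (z, x)) = gaussian z * (LINT x|lborel. ((norm (g x))\<^sup>2 + (norm (g (x - e *\<^sub>R z)))\<^sup>2 - (norm (g (x - e *\<^sub>R z) - g x))\<^sup>2) / 2)"
      unfolding prod.case Re_mult_cnj_polarization by simp
    also have "\<dots> = gaussian z * ((S + S - (LINT x|lborel. (norm (g (x - e *\<^sub>R z) - g x))\<^sup>2)) / 2)"
      using g2 g2t[of "e *\<^sub>R z"] id[of "e *\<^sub>R z"] S[of "e *\<^sub>R z"] by (simp add: S_def)
    finally show "(LINT x|lborel. ?H (z, x)) = gaussian z * (S - (LINT x|lborel. (norm (g (x - e *\<^sub>R z) - g x))\<^sup>2) / 2)"
      by (simp add: diff_divide_distrib)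
  qed
  finally show ?thesis .
qed

text \<open>Let the width of the Gaussian weight tend to infinity: the left-hand side converges monotonically, and the
right-hand side of the preceding lemma converges by continuity of translations in \<open>L\<^sup>2\<close>.\<close>

theorem plancherel:
  fixes g :: "real \<times> real \<Rightarrow> complex"
  assumes g: "integrable lborel g" and g2: "integrable lborel (\<lambda>x. (norm (g x))\<^sup>2)"
  shows "(\<integral>\<^sup>+\<xi>. ennreal ((norm (fourier g \<xi>))\<^sup>2) \<partial>lborel) = ennreal (4 * pi\<^sup>2 * (LINT x|lborel. (norm (g x))\<^sup>2))"
proof -
  have [measurable]: "g \<in> borel_measurable borel" using g by auto
  define S where "S = (LINT x|lborel. (norm (g x))\<^sup>2)"
  \<comment> \<open>Any positive sequence decreasing to \<open>0\<close> would do.\<close>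
  define e where "e n = inverse (real (Suc n))" for n
  have e0: "e n > 0" for n by (simp add: e_def)
  have elim: "e \<longlonglongrightarrow> 0" unfolding e_def by (rule LIMSEQ_inverse_real_of_nat)
  define D where "D v = (LINT x|lborel. (norm (g (x - v) - g x))\<^sup>2)" for v
  have D_measurable [measurable]: "D \<in> borel_measurable borel" unfolding D_def by measurable
  have g2t: "integrable lborel (\<lambda>x. (norm (g (x - a)))\<^sup>2)" for a
    using integrable_lborel_translate[OF g2] .
  have St: "(LINT x|lborel. (norm (g (x - a)))\<^sup>2) = S" for a
    unfolding S_def by (rule integral_lborel_translate) measurable
  have D_le: "D v \<le> 4 * S" for v
  proof -
    have "D v \<le> (LINT x|lborel. 2 * (norm (g (x - v)))\<^sup>2 + 2 * (norm (g x))\<^sup>2)"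
      unfolding D_def using g2 g2t norm_diff_square_le by (intro integral_mono') auto
    also have "\<dots> = 4 * S" using g2 g2t[of v] St[of v] by (simp add: S_def)
    finally show ?thesis .
  qed
  have D0: "D v \<ge> 0" for v by (simp add: D_def)
  have "(\<lambda>n. LINT z|lborel. gaussian z * (S - D (e n *\<^sub>R z) / 2)) \<longlonglongrightarrow> (LINT z|lborel. gaussian z * S)"
  proof (rule integral_dominated_convergence[where w = "\<lambda>z. gaussian z * S"])
    show "AE z in lborel. (\<lambda>n. gaussian z * (S - D (e n *\<^sub>R z) / 2)) \<longlonglongrightarrow> gaussian z * S"
    proof (rule AE_I2)
      fix z :: "real \<times> real"
      have "(\<lambda>n. e n *\<^sub>R z) \<longlonglongrightarrow> 0 *\<^sub>R z" by (intro tendsto_intros elim)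
      then have "(\<lambda>n. D (e n *\<^sub>R z)) \<longlonglongrightarrow> 0"
        unfolding D_def by (intro L2_translation_complex g2) auto
      then have "(\<lambda>n. gaussian z * (S - D (e n *\<^sub>R z) / 2)) \<longlonglongrightarrow> gaussian z * (S - 0 / 2)"
        by (intro tendsto_intros) auto
      then show "(\<lambda>n. gaussian z * (S - D (e n *\<^sub>R z) / 2)) \<longlonglongrightarrow> gaussian z * S" by simp
    qed
    have "\<bar>S - D v / 2\<bar> \<le> S" for v using D_le[of v] D0[of v] by linarith
    from mult_left_mono[OF this less_imp_le[OF gaussian_pos]]
    show "AE z in lborel. norm (gaussian z * (S - D (e n *\<^sub>R z) / 2)) \<le> gaussian z * S" for n
      using gaussian_pos by (simp add: abs_mult less_imp_le)
  qed (use integrable_gaussian in auto)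
  then have "(\<lambda>n. 2 * pi * (LINT z|lborel. gaussian z * (S - D (e n *\<^sub>R z) / 2))) \<longlonglongrightarrow> 2 * pi * (LINT z|lborel. gaussian z * S)"
    by (intro tendsto_intros)
  then have L1: "(\<lambda>n. LINT \<xi>|lborel. (norm (fourier g \<xi>))\<^sup>2 * gaussian (e n *\<^sub>R \<xi>)) \<longlonglongrightarrow> 4 * pi\<^sup>2 * S"
    unfolding weighted_energy_fourier_correlation[OF g g2 e0] S_def[symmetric] D_def[symmetric]
    by (simp add: integral_gaussian power2_eq_square mult_ac)
  have "(\<integral>\<^sup>+\<xi>. ennreal ((norm (fourier g \<xi>))\<^sup>2 * gaussian (e n *\<^sub>R \<xi>)) \<partial>lborel)
     = ennreal (LINT \<xi>|lborel. (norm (fourier g \<xi>))\<^sup>2 * gaussian (e n *\<^sub>R \<xi>))" for n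
  proof (rule nn_integral_eq_integral)
    show "integrable lborel (\<lambda>\<xi>. (norm (fourier g \<xi>))\<^sup>2 * gaussian (e n *\<^sub>R \<xi>))"
    proof (rule Bochner_Integration.integrable_bound)
      show "integrable lborel (\<lambda>\<xi>. (LINT x|lborel. norm (g x))\<^sup>2 * gaussian (e n *\<^sub>R \<xi>))"
        using integrable_gaussian_scaled[of "e n"] e0[of n] by simp
      show "AE \<xi> in lborel. norm ((norm (fourier g \<xi>))\<^sup>2 * gaussian (e n *\<^sub>R \<xi>))
          \<le> norm ((LINT x|lborel. norm (g x))\<^sup>2 * gaussian (e n *\<^sub>R \<xi>))"
        using norm_fourier_le[OF g] gaussian_pos
        by (intro AE_I2) (auto simp: abs_mult less_imp_le intro!: mult_right_mono power_mono)
    qed measurable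
  qed (use gaussian_pos in \<open>auto simp: less_imp_le\<close>)
  then have L2: "(\<lambda>n. \<integral>\<^sup>+\<xi>. ennreal ((norm (fourier g \<xi>))\<^sup>2 * gaussian (e n *\<^sub>R \<xi>)) \<partial>lborel) \<longlonglongrightarrow> ennreal (4 * pi\<^sup>2 * S)"
    using L1 by (simp add: tendsto_ennrealI)
  have "(\<lambda>n. \<integral>\<^sup>+\<xi>. ennreal ((norm (fourier g \<xi>))\<^sup>2 * gaussian (e n *\<^sub>R \<xi>)) \<partial>lborel) \<longlonglongrightarrow> (\<integral>\<^sup>+\<xi>. ennreal ((norm (fourier g \<xi>))\<^sup>2) \<partial>lborel)"
  proof (rule nn_integral_LIMSEQ)
    have "gaussian (e n *\<^sub>R \<xi>) \<le> gaussian (e m *\<^sub>R \<xi>)" if "n \<le> m" for n m \<xi>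
    proof -
      have "e m \<le> e n" using that by (simp add: e_def)
      then have "norm (e m *\<^sub>R \<xi>) \<le> norm (e n *\<^sub>R \<xi>)"
        using e0[of m] e0[of n] by (simp add: mult_right_mono)
      then have "(norm (e m *\<^sub>R \<xi>))\<^sup>2 \<le> (norm (e n *\<^sub>R \<xi>))\<^sup>2" by (intro power_mono) auto
      then show ?thesis by (simp add: gaussian_def)
    qed
    then show "incseq (\<lambda>n \<xi>. ennreal ((norm (fourier g \<xi>))\<^sup>2 * gaussian (e n *\<^sub>R \<xi>)))"
      by (auto simp: incseq_def le_fun_def intro!: ennreal_leI mult_left_mono)
    fix \<xi> :: "real \<times> real"
    have "(\<lambda>n. (norm (fourier g \<xi>))\<^sup>2 * gaussian (e n *\<^sub>R \<xi>)) \<longlonglongrightarrow> (norm (fourier g \<xi>))\<^sup>2 * exp (- (norm (0 *\<^sub>R \<xi>))\<^sup>2 / 2)"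
      unfolding gaussian_def by (intro tendsto_intros elim) auto
    then show "(\<lambda>n. ennreal ((norm (fourier g \<xi>))\<^sup>2 * gaussian (e n *\<^sub>R \<xi>))) \<longlonglongrightarrow> ennreal ((norm (fourier g \<xi>))\<^sup>2)"
      by (intro tendsto_ennrealI) simp
  qed measurable
  from LIMSEQ_unique[OF this L2]
  show ?thesis unfolding S_def .
qed

lemma plancherel_nn:
  fixes g :: "real \<times> real \<Rightarrow> complex"
  assumes g: "integrable lborel g" and fin: "(\<integral>\<^sup>+x. ennreal ((norm (g x))\<^sup>2) \<partial>lborel) < \<infinity>"
  shows "(\<integral>\<^sup>+\<xi>. ennreal ((norm (fourier g \<xi>))\<^sup>2) \<partial>lborel) = ennreal (4 * pi\<^sup>2) * (\<integral>\<^sup>+x. ennreal ((norm (g x))\<^sup>2) \<partial>lborel)"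
proof -
  have [measurable]: "g \<in> borel_measurable borel" using g by auto
  have g2: "integrable lborel (\<lambda>x. (norm (g x))\<^sup>2)"
    using fin by (intro integrableI_nonneg) auto
  show ?thesis
    unfolding plancherel[OF g g2] by (subst nn_integral_eq_integral[OF g2]) (auto simp: ennreal_mult)
qed

lemma plancherel_le:
  fixes g :: "real \<times> real \<Rightarrow> complex"
  assumes g: "integrable lborel g"
  shows "(\<integral>\<^sup>+\<xi>. ennreal ((norm (fourier g \<xi>))\<^sup>2) \<partial>lborel) \<le> ennreal (4 * pi\<^sup>2) * (\<integral>\<^sup>+x. ennreal ((norm (g x))\<^sup>2) \<partial>lborel)"
proof (cases "(\<integral>\<^sup>+x. ennreal ((norm (g x))\<^sup>2) \<partial>lborel) < \<infinity>")
  case True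
  then show ?thesis using plancherel_nn[OF g] by simp
next
  case False
  then show ?thesis by (simp add: less_top[symmetric] ennreal_mult_top)
qed

section \<open>Autoconvolution and the fourth moment of the Fourier transform\<close>

definition autoconv :: "('a::euclidean_space \<Rightarrow> ennreal) \<Rightarrow> 'a \<Rightarrow> ennreal" where
  "autoconv F m = (\<integral>\<^sup>+x. F x * F (m - x) \<partial>lborel)"

lemma autoconv_measurable [measurable]:
  assumes [measurable]: "F \<in> borel_measurable borel"
  shows "autoconv F \<in> borel_measurable borel"
  unfolding autoconv_def by measurable

lemma nn_integral_autoconv:
  fixes F :: "'a::euclidean_space \<Rightarrow> ennreal"
  assumes [measurable]: "F \<in> borel_measurable borel"
  shows "(\<integral>\<^sup>+m. autoconv F m \<partial>lborel) = (\<integral>\<^sup>+x. F x \<partial>lborel)\<^sup>2"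
proof -
  have "(\<integral>\<^sup>+m. autoconv F m \<partial>lborel) = (\<integral>\<^sup>+x. (\<integral>\<^sup>+m. F x * F (m - x) \<partial>lborel) \<partial>lborel)"
    unfolding autoconv_def by (rule lborel_pair.Fubini') measurable
  also have "\<dots> = (\<integral>\<^sup>+x. F x * (\<integral>\<^sup>+m. F m \<partial>lborel) \<partial>lborel)"
    by (simp add: nn_integral_cmult nn_integral_lborel_translate)
  also have "\<dots> = (\<integral>\<^sup>+x. F x \<partial>lborel)\<^sup>2"
    by (simp add: nn_integral_multc power2_eq_square)
  finally show ?thesis .
qed

text \<open>The integrand is regrouped as \<open>F(x) F(m - x)\<close> times \<open>W(x - u) W(m - x - u)\<close> before applying
Cauchy--Schwarz; the second factor is a translate of the integrand of an autoconvolution at \<open>m - 2u\<close>.\<close>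

lemma autoconv_windowed_square_le:
  fixes F W :: "'a::euclidean_space \<Rightarrow> ennreal"
  assumes [measurable]: "F \<in> borel_measurable borel" "W \<in> borel_measurable borel"
  shows "(autoconv (\<lambda>x. F x * W (x - u)) m)\<^sup>2 \<le>
     autoconv (\<lambda>x. (F x)\<^sup>2) m * autoconv (\<lambda>x. (W x)\<^sup>2) (m - 2 *\<^sub>R u)"
proof -
  have "(autoconv (\<lambda>x. F x * W (x - u)) m)\<^sup>2 =
      (\<integral>\<^sup>+x. (F x * F (m - x)) * (W (x - u) * W (m - x - u)) \<partial>lborel)\<^sup>2"
    unfolding autoconv_def by (simp add: mult_ac)
  also have "\<dots> \<le> (\<integral>\<^sup>+x. (F x * F (m - x))\<^sup>2 \<partial>lborel) * (\<integral>\<^sup>+x. (W (x - u) * W (m - x - u))\<^sup>2 \<partial>lborel)"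
    by (rule Cauchy_Schwarz_nn_integral) measurable
  also have "(\<integral>\<^sup>+x. (W (x - u) * W (m - x - u))\<^sup>2 \<partial>lborel) = (\<integral>\<^sup>+x. (W x * W (m - 2 *\<^sub>R u - x))\<^sup>2 \<partial>lborel)"
    using nn_integral_lborel_translate[of "\<lambda>x. (W x * W (m - 2 *\<^sub>R u - x))\<^sup>2" u]
    by (simp add: scaleR_2 algebra_simps)
  finally show ?thesis unfolding autoconv_def by (simp add: power_mult_distrib)
qed

text \<open>The gain \<open>2 ^ DIM('a)\<close> is the Jacobian of \<open>u \<mapsto> m - 2u\<close>. It is sharp, with equality for
\<open>F = W\<close> Gaussian; combined with Plancherel's theorem it is the case \<open>p = 4\<close> of Lieb's inequality for the short-time Fourier transform.\<close>

lemma nn_integral_autoconv_windowed: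
  fixes F W :: "'a::euclidean_space \<Rightarrow> ennreal"
  assumes [measurable]: "F \<in> borel_measurable borel" "W \<in> borel_measurable borel"
  shows "2 ^ DIM('a) * (\<integral>\<^sup>+u. (\<integral>\<^sup>+m. (autoconv (\<lambda>x. F x * W (x - u)) m)\<^sup>2 \<partial>lborel) \<partial>lborel)
     \<le> (\<integral>\<^sup>+x. (F x)\<^sup>2 \<partial>lborel)\<^sup>2 * (\<integral>\<^sup>+x. (W x)\<^sup>2 \<partial>lborel)\<^sup>2"
proof -
  let ?f = "autoconv (\<lambda>x. (F x)\<^sup>2)" and ?w = "autoconv (\<lambda>x. (W x)\<^sup>2)"
  have scale: "2 ^ DIM('a) * (\<integral>\<^sup>+u. ?w (m - 2 *\<^sub>R u) \<partial>lborel) = (\<integral>\<^sup>+x. (W x)\<^sup>2 \<partial>lborel)\<^sup>2" for m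
    using nn_integral_lborel_affine[of ?w "-2" m] by (simp add: nn_integral_autoconv flip: ennreal_power)
  have "(\<integral>\<^sup>+u. (\<integral>\<^sup>+m. (autoconv (\<lambda>x. F x * W (x - u)) m)\<^sup>2 \<partial>lborel) \<partial>lborel)
     \<le> (\<integral>\<^sup>+u. (\<integral>\<^sup>+m. ?f m * ?w (m - 2 *\<^sub>R u) \<partial>lborel) \<partial>lborel)"
    by (intro nn_integral_mono autoconv_windowed_square_le) measurable
  also have "\<dots> = (\<integral>\<^sup>+m. (\<integral>\<^sup>+u. ?f m * ?w (m - 2 *\<^sub>R u) \<partial>lborel) \<partial>lborel)"
    by (rule lborel_pair.Fubini') measurable
  also have "\<dots> = (\<integral>\<^sup>+m. ?f m * (\<integral>\<^sup>+u. ?w (m - 2 *\<^sub>R u) \<partial>lborel) \<partial>lborel)"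
    by (simp add: nn_integral_cmult)
  finally have "2 ^ DIM('a) * (\<integral>\<^sup>+u. (\<integral>\<^sup>+m. (autoconv (\<lambda>x. F x * W (x - u)) m)\<^sup>2 \<partial>lborel) \<partial>lborel)
     \<le> 2 ^ DIM('a) * (\<integral>\<^sup>+m. ?f m * (\<integral>\<^sup>+u. ?w (m - 2 *\<^sub>R u) \<partial>lborel) \<partial>lborel)"
    by (rule mult_left_mono) simp
  also have "\<dots> = (\<integral>\<^sup>+m. ?f m * (2 ^ DIM('a) * (\<integral>\<^sup>+u. ?w (m - 2 *\<^sub>R u) \<partial>lborel)) \<partial>lborel)"
    by (simp add: nn_integral_cmult[symmetric] mult.left_commute)
  also have "\<dots> = (\<integral>\<^sup>+x. (F x)\<^sup>2 \<partial>lborel)\<^sup>2 * (\<integral>\<^sup>+x. (W x)\<^sup>2 \<partial>lborel)\<^sup>2"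
    unfolding scale by (simp add: nn_integral_multc nn_integral_autoconv)
  finally show ?thesis .
qed

lemma
  fixes g :: "'a::euclidean_space \<Rightarrow> complex"
  assumes g: "integrable lborel g"
  shows integrable_self_convolution: "integrable lborel (\<lambda>m. LINT x|lborel. g x * g (m - x))"
    and fourier_self_convolution: "fourier (\<lambda>m. LINT x|lborel. g x * g (m - x)) \<xi> = (fourier g \<xi>)\<^sup>2"
proof -
  have [measurable]: "g \<in> borel_measurable borel" using g by auto
  have i: "integrable (lborel \<Otimes>\<^sub>M lborel) (\<lambda>(x, m). g x * g (m - x))"
  proof (rule lborel_pair.Fubini_integrable)
    have "(LINT m|lborel. norm (g x * g (m - x))) = norm (g x) * (LINT m|lborel. norm (g m))" for x
      using integral_lborel_translate[of "\<lambda>m. norm (g m)" x] by (simp add: norm_mult)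
    then show "integrable lborel (\<lambda>x. LINT m|lborel. norm (case (x, m) of (x, m) \<Rightarrow> g x * g (m - x)))"
      using g by simp
    show "AE x in lborel. integrable lborel (\<lambda>m. case (x, m) of (x, m) \<Rightarrow> g x * g (m - x))"
      using integrable_lborel_translate[OF g] by simp
  qed measurable
  show "integrable lborel (\<lambda>m. LINT x|lborel. g x * g (m - x))"
    using lborel_pair.integrable_snd[OF i] .
  have "integrable (lborel \<Otimes>\<^sub>M lborel) (\<lambda>q. cis (- (snd q \<bullet> \<xi>)) * (case q of (x, m) \<Rightarrow> g x * g (m - x)))"
    by (rule integrable_cis_mult[OF i]) measurable
  then have i': "integrable (lborel \<Otimes>\<^sub>M lborel) (\<lambda>(x, m). cis (- (m \<bullet> \<xi>)) * (g x * g (m - x)))"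
    by (simp add: case_prod_beta')
  have "fourier (\<lambda>m. LINT x|lborel. g x * g (m - x)) \<xi> = (LINT m|lborel. LINT x|lborel. cis (- (m \<bullet> \<xi>)) * (g x * g (m - x)))"
    unfolding fourier_def by simp
  also have "\<dots> = (LINT x|lborel. LINT m|lborel. cis (- (m \<bullet> \<xi>)) * (g x * g (m - x)))"
    using lborel_pair.Fubini_integral[OF i'] .
  also have "\<dots> = (LINT x|lborel. (cis (- (x \<bullet> \<xi>)) * g x) * fourier g \<xi>)"
  proof (intro Bochner_Integration.integral_cong refl)
    fix x
    have "(LINT m|lborel. cis (- (m \<bullet> \<xi>)) * (g x * g (m - x))) =
       (LINT m|lborel. (cis (- (x \<bullet> \<xi>)) * g x) * (cis (- ((m - x) \<bullet> \<xi>)) * g (m - x)))"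
    proof (intro Bochner_Integration.integral_cong refl)
      fix m
      have "cis (- (m \<bullet> \<xi>)) = cis (- (x \<bullet> \<xi>)) * cis (- ((m - x) \<bullet> \<xi>))"
        by (simp add: cis_mult inner_diff_left)
      then show "cis (- (m \<bullet> \<xi>)) * (g x * g (m - x)) = (cis (- (x \<bullet> \<xi>)) * g x) * (cis (- ((m - x) \<bullet> \<xi>)) * g (m - x))"
        by simp
    qed
    also have "\<dots> = (cis (- (x \<bullet> \<xi>)) * g x) * (LINT m|lborel. cis (- ((m - x) \<bullet> \<xi>)) * g (m - x))"
      by simp
    also have "(LINT m|lborel. cis (- ((m - x) \<bullet> \<xi>)) * g (m - x)) = fourier g \<xi>"
      unfolding fourier_def by (rule integral_lborel_translate) measurable
    finally show "(LINT m|lborel. cis (- (m \<bullet> \<xi>)) * (g x * g (m - x))) = (cis (- (x \<bullet> \<xi>)) * g x) * fourier g \<xi>" .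
  qed
  also have "\<dots> = (fourier g \<xi>)\<^sup>2"
    by (simp add: fourier_def power2_eq_square)
  finally show "fourier (\<lambda>m. LINT x|lborel. g x * g (m - x)) \<xi> = (fourier g \<xi>)\<^sup>2" .
qed

text \<open>The square of a Fourier transform is the transform of a self-convolution, so the fourth power is
an \<open>L\<^sup>2\<close> quantity, and the self-convolution is dominated by the autoconvolution of \<open>|g|\<close>.\<close>

lemma fourier_fourth_power_le:
  fixes g :: "real \<times> real \<Rightarrow> complex"
  assumes g: "integrable lborel g"
  shows "(\<integral>\<^sup>+\<xi>. ennreal ((norm (fourier g \<xi>)) ^ 4) \<partial>lborel) \<le>
     ennreal (4 * pi\<^sup>2) * (\<integral>\<^sup>+m. (autoconv (\<lambda>x. ennreal (norm (g x))) m)\<^sup>2 \<partial>lborel)"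
proof -
  let ?c = "\<lambda>m. LINT x|lborel. g x * g (m - x)"
  have [measurable]: "g \<in> borel_measurable borel" using g by auto
  have "(\<integral>\<^sup>+\<xi>. ennreal ((norm (fourier g \<xi>)) ^ 4) \<partial>lborel) = (\<integral>\<^sup>+\<xi>. ennreal ((norm (fourier ?c \<xi>))\<^sup>2) \<partial>lborel)"
    unfolding fourier_self_convolution[OF g] by (simp add: norm_power power_mult[symmetric])
  also have "\<dots> \<le> ennreal (4 * pi\<^sup>2) * (\<integral>\<^sup>+m. ennreal ((norm (?c m))\<^sup>2) \<partial>lborel)"
    by (rule plancherel_le[OF integrable_self_convolution[OF g]])
  also have "(\<integral>\<^sup>+m. ennreal ((norm (?c m))\<^sup>2) \<partial>lborel) \<le> (\<integral>\<^sup>+m. (autoconv (\<lambda>x. ennreal (norm (g x))) m)\<^sup>2 \<partial>lborel)"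
  proof (rule nn_integral_mono)
    fix m :: "real \<times> real"
    have "ennreal (norm (?c m)) \<le> (\<integral>\<^sup>+x. norm (g x * g (m - x)) \<partial>lborel)"
    proof (cases "integrable lborel (\<lambda>x. g x * g (m - x))")
      case True then show ?thesis by (rule integral_norm_bound_ennreal)
    qed (simp add: not_integrable_integral_eq)
    also have "\<dots> = autoconv (\<lambda>x. ennreal (norm (g x))) m"
      unfolding autoconv_def by (simp add: norm_mult ennreal_mult)
    finally show "ennreal ((norm (?c m))\<^sup>2) \<le> (autoconv (\<lambda>x. ennreal (norm (g x))) m)\<^sup>2"
      by (simp add: ennreal_power[symmetric] power_mono)
  qed
  finally show ?thesis by (simp add: mult_left_mono)
qed

lemma nn_integral_lborel_prod_scale:
  fixes F :: "real \<times> real \<Rightarrow> ennreal"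
  assumes [measurable]: "F \<in> borel_measurable borel" and b: "b\<^sub>1 \<noteq> 0" "b\<^sub>2 \<noteq> 0"
  shows "(\<integral>\<^sup>+w. F (fst w / b\<^sub>1, snd w / b\<^sub>2) \<partial>lborel) = ennreal \<bar>b\<^sub>1 * b\<^sub>2\<bar> * (\<integral>\<^sup>+\<xi>. F \<xi> \<partial>lborel)"
proof -
  have [measurable]: "F \<in> borel_measurable (lborel \<Otimes>\<^sub>M lborel)" by (simp add: lborel_prod)
  have inner: "(\<integral>\<^sup>+y. F (a, y / b\<^sub>2) \<partial>lborel) = ennreal \<bar>b\<^sub>2\<bar> * (\<integral>\<^sup>+y. F (a, y) \<partial>lborel)" for a
    using b by (subst nn_integral_real_affine[where c = b\<^sub>2 and t = 0]) auto
  have m: "(\<lambda>w. F (fst w / b\<^sub>1, snd w / b\<^sub>2)) \<in> borel_measurable (lborel \<Otimes>\<^sub>M lborel)" by measurable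
  have "(\<integral>\<^sup>+w. F (fst w / b\<^sub>1, snd w / b\<^sub>2) \<partial>lborel) = (\<integral>\<^sup>+w. F (fst w / b\<^sub>1, snd w / b\<^sub>2) \<partial>(lborel \<Otimes>\<^sub>M lborel))"
    by (simp only: lborel_prod)
  also have "\<dots> = (\<integral>\<^sup>+x. (\<integral>\<^sup>+y. F (x / b\<^sub>1, y / b\<^sub>2) \<partial>lborel) \<partial>lborel)"
    using lborel.nn_integral_fst[OF m] by simp
  also have "\<dots> = ennreal \<bar>b\<^sub>2\<bar> * (\<integral>\<^sup>+x. (\<integral>\<^sup>+y. F (x / b\<^sub>1, y) \<partial>lborel) \<partial>lborel)"
    unfolding inner by (rule nn_integral_cmult) measurable
  also have "(\<integral>\<^sup>+x. (\<integral>\<^sup>+y. F (x / b\<^sub>1, y) \<partial>lborel) \<partial>lborel) = ennreal \<bar>b\<^sub>1\<bar> * (\<integral>\<^sup>+x. (\<integral>\<^sup>+y. F (x, y) \<partial>lborel) \<partial>lborel)"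
    using b by (subst nn_integral_real_affine[where c = b\<^sub>1 and t = 0]) auto
  also have "(\<integral>\<^sup>+x. (\<integral>\<^sup>+y. F (x, y) \<partial>lborel) \<partial>lborel) = (\<integral>\<^sup>+\<xi>. F \<xi> \<partial>lborel)"
    using lborel.nn_integral_fst[of F lborel] by (simp add: lborel_prod)
  finally show ?thesis by (simp add: abs_mult ennreal_mult mult_ac)
qed

section \<open>Fourier integrals with quadratic phases\<close>

text \<open>The part \<open>\<beta>\<close> of the phase has no effect on absolute values, and the part \<open>\<alpha>\<close> can be absorbed into
the transformed function without changing its absolute value.\<close>

lemma chirped_kernel_transform:
  fixes k :: "real \<times> real \<Rightarrow> real \<times> real \<Rightarrow> complex"
  assumes k: "\<And>x w. k x w = C * cis (\<alpha> x + \<beta> w - (fst x * fst w / b\<^sub>1 + snd x * snd w / b\<^sub>2))"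
  shows "(norm (LINT x|lborel. k x w * z x)) =
     norm C * norm (fourier (\<lambda>x. cis (\<alpha> x) * z x) (fst w / b\<^sub>1, snd w / b\<^sub>2))"
proof -
  have kz: "k x w * z x = (C * cis (\<beta> w)) * (cis (- (x \<bullet> (fst w / b\<^sub>1, snd w / b\<^sub>2))) * (cis (\<alpha> x) * z x))" for x
  proof -
    have "cis (\<alpha> x + \<beta> w - (fst x * fst w / b\<^sub>1 + snd x * snd w / b\<^sub>2)) =
       cis (\<beta> w) * (cis (- (x \<bullet> (fst w / b\<^sub>1, snd w / b\<^sub>2))) * cis (\<alpha> x))"
      by (simp add: cis_mult inner_prod_def algebra_simps)
    then show ?thesis unfolding k by (simp only: mult_ac)
  qed
  show ?thesis
    unfolding kz fourier_def by (simp add: norm_mult)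
qed

lemma
  fixes k :: "real \<times> real \<Rightarrow> real \<times> real \<Rightarrow> complex"
  assumes k: "\<And>x w. k x w = C * cis (\<alpha> x + \<beta> w - (fst x * fst w / b\<^sub>1 + snd x * snd w / b\<^sub>2))"
    and \<alpha> [measurable]: "\<alpha> \<in> borel_measurable borel" and b: "b\<^sub>1 \<noteq> 0" "b\<^sub>2 \<noteq> 0"
    and C: "(norm C)\<^sup>2 * (4 * pi\<^sup>2 * \<bar>b\<^sub>1 * b\<^sub>2\<bar>) = 1" and z: "integrable lborel z"
  shows chirped_kernel_energy: "(\<integral>\<^sup>+x. ennreal ((norm (z x))\<^sup>2) \<partial>lborel) < \<infinity> \<Longrightarrow>
      (\<integral>\<^sup>+w. ennreal ((norm (LINT x|lborel. k x w * z x))\<^sup>2) \<partial>lborel) = (\<integral>\<^sup>+x. ennreal ((norm (z x))\<^sup>2) \<partial>lborel)"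
    and chirped_kernel_fourth_power: "(\<integral>\<^sup>+w. ennreal ((norm (LINT x|lborel. k x w * z x)) ^ 4) \<partial>lborel) \<le>
      ennreal ((norm C)\<^sup>2) * (\<integral>\<^sup>+m. (autoconv (\<lambda>x. ennreal (norm (z x))) m)\<^sup>2 \<partial>lborel)"
proof -
  let ?g = "\<lambda>x. cis (\<alpha> x) * z x"
  have [measurable]: "z \<in> borel_measurable borel" using z by auto
  have g: "integrable lborel ?g" by (rule integrable_cis_mult[OF z]) measurable
  have ng: "norm (?g x) = norm (z x)" for x by (simp add: norm_mult)
  have scale: "(\<integral>\<^sup>+w. ennreal ((norm (LINT x|lborel. k x w * z x)) ^ n) \<partial>lborel) =
     ennreal (norm C ^ n * \<bar>b\<^sub>1 * b\<^sub>2\<bar>) * (\<integral>\<^sup>+\<xi>. ennreal (norm (fourier ?g \<xi>) ^ n) \<partial>lborel)" for n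
  proof -
    have "(\<integral>\<^sup>+w. ennreal ((norm (LINT x|lborel. k x w * z x)) ^ n) \<partial>lborel) =
       ennreal (norm C ^ n) * (\<integral>\<^sup>+w. ennreal (norm (fourier ?g (fst w / b\<^sub>1, snd w / b\<^sub>2)) ^ n) \<partial>lborel)"
      unfolding chirped_kernel_transform[OF k] power_mult_distrib
      by (subst nn_integral_cmult[symmetric]) (measurable, simp add: ennreal_mult)
    also have "\<dots> = ennreal (norm C ^ n) * (ennreal \<bar>b\<^sub>1 * b\<^sub>2\<bar> * (\<integral>\<^sup>+\<xi>. ennreal (norm (fourier ?g \<xi>) ^ n) \<partial>lborel))"
      by (subst nn_integral_lborel_prod_scale[OF _ b]) auto
    finally show ?thesis by (simp add: ennreal_mult mult.assoc)
  qed
  {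
    assume "(\<integral>\<^sup>+x. ennreal ((norm (z x))\<^sup>2) \<partial>lborel) < \<infinity>"
    then have "(\<integral>\<^sup>+\<xi>. ennreal ((norm (fourier ?g \<xi>))\<^sup>2) \<partial>lborel)
        = ennreal (4 * pi\<^sup>2) * (\<integral>\<^sup>+x. ennreal ((norm (z x))\<^sup>2) \<partial>lborel)"
      using plancherel_nn[OF g] unfolding ng by simp
    then have "(\<integral>\<^sup>+w. ennreal ((norm (LINT x|lborel. k x w * z x))\<^sup>2) \<partial>lborel) =
      ennreal ((norm C)\<^sup>2 * \<bar>b\<^sub>1 * b\<^sub>2\<bar>) * (ennreal (4 * pi\<^sup>2) * (\<integral>\<^sup>+x. ennreal ((norm (z x))\<^sup>2) \<partial>lborel))"
      unfolding scale by simp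
    also have "\<dots> = ennreal ((norm C)\<^sup>2 * \<bar>b\<^sub>1 * b\<^sub>2\<bar> * (4 * pi\<^sup>2)) * (\<integral>\<^sup>+x. ennreal ((norm (z x))\<^sup>2) \<partial>lborel)"
      by (simp add: ennreal_mult mult.assoc)
    also have "(norm C)\<^sup>2 * \<bar>b\<^sub>1 * b\<^sub>2\<bar> * (4 * pi\<^sup>2) = 1" using C by (simp only: mult_ac)
    finally show "(\<integral>\<^sup>+w. ennreal ((norm (LINT x|lborel. k x w * z x))\<^sup>2) \<partial>lborel) = (\<integral>\<^sup>+x. ennreal ((norm (z x))\<^sup>2) \<partial>lborel)"
      by simp
  }
  have "(\<integral>\<^sup>+w. ennreal ((norm (LINT x|lborel. k x w * z x)) ^ 4) \<partial>lborel) \<le>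
     ennreal (norm C ^ 4 * \<bar>b\<^sub>1 * b\<^sub>2\<bar>) * (ennreal (4 * pi\<^sup>2) * (\<integral>\<^sup>+m. (autoconv (\<lambda>x. ennreal (norm (z x))) m)\<^sup>2 \<partial>lborel))"
    unfolding scale using fourier_fourth_power_le[OF g] unfolding ng by (intro mult_left_mono) auto
  also have "\<dots> = ennreal (norm C ^ 4 * \<bar>b\<^sub>1 * b\<^sub>2\<bar> * (4 * pi\<^sup>2)) * (\<integral>\<^sup>+m. (autoconv (\<lambda>x. ennreal (norm (z x))) m)\<^sup>2 \<partial>lborel)"
    by (simp add: ennreal_mult mult.assoc)
  also have "norm C ^ 4 * \<bar>b\<^sub>1 * b\<^sub>2\<bar> * (4 * pi\<^sup>2) = (norm C)\<^sup>2"
  proof -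
    have "norm C ^ 4 * \<bar>b\<^sub>1 * b\<^sub>2\<bar> * (4 * pi\<^sup>2) = (norm C)\<^sup>2 * ((norm C)\<^sup>2 * (4 * pi\<^sup>2 * \<bar>b\<^sub>1 * b\<^sub>2\<bar>))"
      by (simp only: power2_eq_square power4_eq_xxxx mult_ac)
    then show ?thesis using C by simp
  qed
  finally show "(\<integral>\<^sup>+w. ennreal ((norm (LINT x|lborel. k x w * z x)) ^ 4) \<partial>lborel) \<le>
      ennreal ((norm C)\<^sup>2) * (\<integral>\<^sup>+m. (autoconv (\<lambda>x. ennreal (norm (z x))) m)\<^sup>2 \<partial>lborel)" .
qed

section \<open>Splitting a two-sided quaternionic integral into complex ones\<close>

text \<open>In terms of the orthogonal decomposition of \<open>q\<close> into \<open>(q \<plusminus> i q j) / 2\<close>, the summand with the plus sign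
is \<open>quat_plus q * (1 + k) / 2\<close> and the one with the minus sign is \<open>quat_minus q * (1 - k) / 2\<close>, where complex
numbers are read in \<open>\<real> + \<real>i\<close>.\<close>

definition quat_plus :: "quat \<Rightarrow> complex" where
  "quat_plus q = Complex (qRe q + qIm3 q) (qIm1 q - qIm2 q)"

definition quat_minus :: "quat \<Rightarrow> complex" where
  "quat_minus q = Complex (qRe q - qIm3 q) (qIm1 q + qIm2 q)"

lemma quat_slice_sel:
  "qRe (quat_slice quat_i z) = Re z" "qIm1 (quat_slice quat_i z) = Im z"
  "qIm2 (quat_slice quat_i z) = 0" "qIm3 (quat_slice quat_i z) = 0"
  "qRe (quat_slice quat_j z) = Re z" "qIm1 (quat_slice quat_j z) = 0"
  "qIm2 (quat_slice quat_j z) = Im z" "qIm3 (quat_slice quat_j z) = 0"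
  by (simp_all add: quat_slice_def of_real_def quat_i_def quat_j_def)

text \<open>Here \<open>(1 + k) j = - i (1 + k)\<close>: a factor in \<open>\<real> + \<real>j\<close> on the right moves to the left
and is conjugated on the way. For \<open>quat_minus\<close> the relation is \<open>(1 - k) j = i (1 - k)\<close>, without conjugation.\<close>

lemma quat_plus_two_sided:
  "quat_plus (quat_slice quat_i a * q * quat_slice quat_j b) = a * cnj b * quat_plus q"
  by (simp add: quat_plus_def quat_slice_sel complex_eq_iff algebra_simps)

lemma quat_minus_two_sided:
  "quat_minus (quat_slice quat_i a * q * quat_slice quat_j b) = a * b * quat_minus q"
  by (simp add: quat_minus_def quat_slice_sel complex_eq_iff algebra_simps)

lemma norm_quat_plus_minus:
  "(norm q)\<^sup>2 = ((norm (quat_plus q))\<^sup>2 + (norm (quat_minus q))\<^sup>2) / 2"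
  unfolding cmod_power2 by (simp add: norm_quat_def quat_plus_def quat_minus_def power2_eq_square algebra_simps)

lemma norm_quat_plus_le: "norm (quat_plus q) \<le> norm q * 2"
proof (rule power2_le_imp_le)
  show "(norm (quat_plus q))\<^sup>2 \<le> (norm q * 2)\<^sup>2"
    unfolding power_mult_distrib norm_quat_plus_minus
    using zero_le_power2[of "norm (quat_plus q)"] zero_le_power2[of "norm (quat_minus q)"] by simp
qed simp

lemma norm_quat_minus_le: "norm (quat_minus q) \<le> norm q * 2"
proof (rule power2_le_imp_le)
  show "(norm (quat_minus q))\<^sup>2 \<le> (norm q * 2)\<^sup>2"
    unfolding power_mult_distrib norm_quat_plus_minus
    using zero_le_power2[of "norm (quat_plus q)"] zero_le_power2[of "norm (quat_minus q)"] by simp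
qed simp

lemma bounded_linear_quat_plus: "bounded_linear quat_plus"
  by (rule bounded_linear_intro[where K = 2, OF _ _ norm_quat_plus_le])
    (simp_all add: quat_plus_def complex_eq_iff algebra_simps)

lemma bounded_linear_quat_minus: "bounded_linear quat_minus"
  by (rule bounded_linear_intro[where K = 2, OF _ _ norm_quat_minus_le])
    (simp_all add: quat_minus_def complex_eq_iff algebra_simps)

lemma quat_slice_mult:
  assumes "u * u = -1"
  shows "quat_slice u (z * w) = quat_slice u z * quat_slice u w"
  using assms by (simp add: quat_slice_def of_real_def algebra_simps)

lemma quat_slice_one [simp]: "quat_slice u 1 = 1"
  by (simp add: quat_slice_def)

lemma bounded_linear_quat_slice: "bounded_linear (quat_slice u)"
proof (rule bounded_linear_intro[where K = "1 + norm u"])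
  fix z :: complex
  have "norm (quat_slice u z) \<le> \<bar>Re z\<bar> + \<bar>Im z\<bar> * norm u"
    unfolding quat_slice_def by (rule order_trans[OF norm_triangle_ineq]) simp
  also have "\<dots> \<le> norm z + norm z * norm u"
    by (intro add_mono mult_right_mono abs_Re_le_cmod abs_Im_le_cmod) simp
  finally show "norm (quat_slice u z) \<le> norm z * (1 + norm u)" by (simp add: algebra_simps)
qed (simp_all add: quat_slice_def of_real_def algebra_simps)

lemma quat_slice_divide_one:
  assumes "u * u = -1" "z \<noteq> 0"
  shows "1 / quat_slice u z = quat_slice u (1 / z)"
proof -
  have "quat_slice u (1 / z) * quat_slice u z = 1"
    using assms by (simp flip: quat_slice_mult)
  then show ?thesis
    by (metis inverse_unique inverse_eq_divide inverse_inverse_eq)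
qed

text \<open>The slice map is a continuous algebra homomorphism on the complex numbers, hence commutes with the
exponential series.\<close>

lemma exp_quat_slice:
  assumes u: "u * u = -1"
  shows "exp (r *\<^sub>R u) = quat_slice u (cis r)"
proof -
  have pow: "quat_slice u (z ^ n) = quat_slice u z ^ n" for z n
    by (induction n) (simp_all add: quat_slice_mult[OF u])
  have "exp (quat_slice u (\<i> * r)) = (\<Sum>n. quat_slice u ((\<i> * r) ^ n /\<^sub>R fact n))"
    unfolding exp_def by (simp add: pow linear_scale bounded_linear.linear[OF bounded_linear_quat_slice])
  also have "\<dots> = quat_slice u (\<Sum>n. (\<i> * r) ^ n /\<^sub>R fact n)"
    using summable_exp_generic by (rule bounded_linear.suminf[OF bounded_linear_quat_slice, symmetric])
  also have "\<dots> = quat_slice u (cis r)"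
    by (simp add: cis_conv_exp exp_def)
  finally show ?thesis by (simp add: quat_slice_def)
qed

section \<open>The linear canonical kernel\<close>

definition complex_LCT_kernel :: "real^2^2 \<Rightarrow> real \<Rightarrow> real \<Rightarrow> complex" where
  "complex_LCT_kernel A x \<omega> = 1 / csqrt (of_real (2 * pi * A $ 1 $ 2)) *
     cis (A $ 1 $ 1 / (2 * A $ 1 $ 2) * x\<^sup>2 - x * \<omega> / A $ 1 $ 2 + A $ 2 $ 2 / (2 * A $ 1 $ 2) * \<omega>\<^sup>2 - pi / 4)"

lemma LCT_kernel_eq_slice:
  assumes "u * u = -1" "A $ 1 $ 2 \<noteq> 0"
  shows "LCT_kernel u A x \<omega> = quat_slice u (complex_LCT_kernel A x \<omega>)"
  unfolding LCT_kernel_def complex_LCT_kernel_def Let_def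
  unfolding exp_quat_slice[OF assms(1)] quat_slice_mult[OF assms(1)]
  using assms by (subst quat_slice_divide_one) auto

section \<open>Borel representatives\<close>

lemma lebesgue_ex_borel:
  fixes f :: "'a::euclidean_space \<Rightarrow> 'b::euclidean_space"
  assumes "f \<in> borel_measurable lebesgue"
  obtains f' where "f' \<in> borel_measurable borel" "AE x in lborel. f x = f' x"
proof -
  have "\<exists>g\<in>borel_measurable lborel. (AE x in lborel. f x \<bullet> b = g x)" for b
    by (intro completion_ex_borel_measurable_real borel_measurable_inner assms borel_measurable_const)
  then obtain g where g: "\<And>b. g b \<in> borel_measurable lborel" "\<And>b. AE x in lborel. f x \<bullet> b = g b x"
    by metis
  note [measurable] = g(1)
  have "AE x in lborel. \<forall>b\<in>Basis. f x \<bullet> b = g b x"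
    using g(2) by (intro AE_finite_allI) auto
  then have "AE x in lborel. f x = (\<Sum>b\<in>Basis. g b x *\<^sub>R b)"
  proof eventually_elim
    case (elim x)
    have "f x = (\<Sum>b\<in>Basis. (f x \<bullet> b) *\<^sub>R b)" by (rule euclidean_representation[symmetric])
    also have "\<dots> = (\<Sum>b\<in>Basis. g b x *\<^sub>R b)" using elim by (intro sum.cong) auto
    finally show ?case .
  qed
  moreover have "(\<lambda>x. \<Sum>b\<in>Basis. g b x *\<^sub>R b) \<in> borel_measurable borel" by measurable
  ultimately show ?thesis by (rule that[rotated])
qed

lemma AE_lborel_translate:
  fixes P :: "'a::euclidean_space \<Rightarrow> bool"
  assumes "AE x in lborel. P x"
  shows "AE x in lborel. P (x - a)"
proof -
  obtain N where N: "{x \<in> space lborel. \<not> P x} \<subseteq> N" "emeasure lborel N = 0" "N \<in> sets lborel"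
    using assms by (rule AE_E)
  have [measurable]: "N \<in> sets borel" using N by simp
  have "(\<integral>\<^sup>+x. indicator N (x - a) \<partial>lborel) = (\<integral>\<^sup>+x. indicator N x \<partial>lborel)"
    by (rule nn_integral_lborel_translate) measurable
  also have "\<dots> = 0" using N by simp
  finally have "AE x in lborel. indicator N (x - a) = (0::ennreal)"
    by (subst (asm) nn_integral_0_iff_AE) measurable
  then show ?thesis
    by eventually_elim (use N(1) in \<open>auto simp: indicator_def split: if_splits\<close>)
qed

lemma bounded_linear_qcnj: "bounded_linear qcnj"
  by (rule bounded_linear_intro[where K = 1]) (simp_all add: quat_eq_iff norm_quat_def)

lemma norm_qcnj [simp]: "norm (qcnj q) = norm q"
  by (simp add: norm_quat_def)

lemma bounded_linear_borel_measurable: "bounded_linear f \<Longrightarrow> f \<in> borel_measurable borel"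
  by (intro borel_measurable_continuous_onI linear_continuous_on)

lemmas quat_measurable [measurable] =
  bounded_linear_qcnj[THEN bounded_linear_borel_measurable]
  bounded_linear_quat_plus[THEN bounded_linear_borel_measurable]
  bounded_linear_quat_minus[THEN bounded_linear_borel_measurable]
  bounded_linear_quat_slice[THEN bounded_linear_borel_measurable]

lemma complex_LCT_kernel_measurable [measurable]:
  assumes [measurable]: "X \<in> borel_measurable M" "Y \<in> borel_measurable M"
  shows "(\<lambda>z. complex_LCT_kernel A (X z) (Y z)) \<in> borel_measurable M"
  unfolding complex_LCT_kernel_def by measurable

lemma quat_i_square: "quat_i * quat_i = -1" and quat_j_square: "quat_j * quat_j = -1"
  by (rule quat_units)+

lemma norm_quat_slice [simp]:
  "norm (quat_slice quat_i z) = norm z" "norm (quat_slice quat_j z) = norm z"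
  by (simp_all add: norm_quat_def quat_slice_sel cmod_def)

text \<open>The transform sees only the classes of \<open>f\<close> and \<open>\<phi>\<close> modulo null sets, so Borel representatives may be used
for every \<open>(w, u)\<close>; products and iterated integrals are then free of completions.\<close>

lemma QWLCT_eq_borel_representatives:
  assumes b: "A\<^sub>1 $ 1 $ 2 \<noteq> 0" "A\<^sub>2 $ 1 $ 2 \<noteq> 0"
    and m[measurable]: "f \<in> borel_measurable lebesgue" "\<phi> \<in> borel_measurable lebesgue"
      "f' \<in> borel_measurable borel" "\<phi>' \<in> borel_measurable borel"
    and ae: "AE x in lborel. f x = f' x" "AE x in lborel. \<phi> x = \<phi>' x"
  shows "QWLCT A\<^sub>1 A\<^sub>2 \<phi> f w u = (LINT x|lborel. quat_slice quat_i (complex_LCT_kernel A\<^sub>1 (fst x) (fst w)) *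
     (f' x * qcnj (\<phi>' (x - u))) * quat_slice quat_j (complex_LCT_kernel A\<^sub>2 (snd x) (snd w)))"
proof -
  let ?k1 = "\<lambda>x. quat_slice quat_i (complex_LCT_kernel A\<^sub>1 (fst x) (fst w))"
  let ?k2 = "\<lambda>x. quat_slice quat_j (complex_LCT_kernel A\<^sub>2 (snd x) (snd w))"
  have "(\<lambda>x. x - u) \<in> lebesgue \<rightarrow>\<^sub>M lebesgue"
    using lebesgue_affine_measurable[of "\<lambda>_. 1" "-u"] by (simp add: euclidean_representation)
  then have [measurable]: "(\<lambda>x. \<phi> (x - u)) \<in> borel_measurable lebesgue"
    by (rule measurable_compose) measurable
  have [measurable]: "?k1 \<in> borel_measurable lebesgue" "?k2 \<in> borel_measurable lebesgue"
    by (rule measurable_completion, measurable)+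
  have b': "(\<lambda>x. ?k1 x * (f' x * qcnj (\<phi>' (x - u))) * ?k2 x) \<in> borel_measurable borel" by measurable
  then have [measurable]: "(\<lambda>x. ?k1 x * (f' x * qcnj (\<phi>' (x - u))) * ?k2 x) \<in> borel_measurable lebesgue"
    by (intro measurable_completion) simp
  have "QWLCT A\<^sub>1 A\<^sub>2 \<phi> f w u = (LINT x|lebesgue. ?k1 x * (f x * qcnj (\<phi> (x - u))) * ?k2 x)"
    unfolding QWLCT_def LCT_kernel_eq_slice[OF quat_i_square b(1)] LCT_kernel_eq_slice[OF quat_j_square b(2)]
    by (simp add: mult.assoc)
  also have "\<dots> = (LINT x|lebesgue. ?k1 x * (f' x * qcnj (\<phi>' (x - u))) * ?k2 x)"
  proof (rule integral_cong_AE)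
    have "AE x in lborel. ?k1 x * (f x * qcnj (\<phi> (x - u))) * ?k2 x = ?k1 x * (f' x * qcnj (\<phi>' (x - u))) * ?k2 x"
      using ae(1) AE_lborel_translate[OF ae(2), of u] by eventually_elim simp
    then show "AE x in lebesgue. ?k1 x * (f x * qcnj (\<phi> (x - u))) * ?k2 x = ?k1 x * (f' x * qcnj (\<phi>' (x - u))) * ?k2 x"
      by (rule AE_completion)
  qed measurable
  also have "\<dots> = (LINT x|lborel. ?k1 x * (f' x * qcnj (\<phi>' (x - u))) * ?k2 x)"
    using b' by (intro integral_completion) simp
  finally show ?thesis .
qed

lemma integrable_windowed:
  fixes f \<phi> :: "'a::euclidean_space \<Rightarrow> quat"
  assumes [measurable]: "f \<in> borel_measurable borel" "\<phi> \<in> borel_measurable borel"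
    and i: "integrable lborel (\<lambda>x. (norm (f x))\<^sup>2)" "integrable lborel (\<lambda>x. (norm (\<phi> x))\<^sup>2)"
  shows "integrable lborel (\<lambda>x. f x * qcnj (\<phi> (x - u)))"
proof (rule Bochner_Integration.integrable_bound)
  show "integrable lborel (\<lambda>x. (norm (f x))\<^sup>2 + (norm (\<phi> (x - u)))\<^sup>2)"
    using i integrable_lborel_translate[OF i(2), of u] by auto
  have "a * b \<le> a\<^sup>2 + b\<^sup>2" if "a \<ge> 0" "b \<ge> 0" for a b :: real
    using sum_squares_bound[of a b] mult_nonneg_nonneg[OF that] by linarith
  then show "AE x in lborel. norm (f x * qcnj (\<phi> (x - u))) \<le> norm ((norm (f x))\<^sup>2 + (norm (\<phi> (x - u)))\<^sup>2)"
    by (simp add: norm_mult)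
qed measurable

section \<open>Moments of the planar linear canonical transform\<close>

lemma norm_csqrt_square: "(norm (csqrt z))\<^sup>2 = norm z"
  by (simp flip: norm_power)

text \<open>The two alternatives for \<open>k\<close> are the kernels acting on the coordinates \<open>quat_plus\<close> and \<open>quat_minus\<close>.
Conjugating the second factor only changes the sign of \<open>b\<^sub>2\<close> in the linear part of the phase.\<close>

lemma
  fixes A\<^sub>1 A\<^sub>2 :: "real^2^2" and z :: "real \<times> real \<Rightarrow> complex"
  assumes b: "A\<^sub>1 $ 1 $ 2 \<noteq> 0" "A\<^sub>2 $ 1 $ 2 \<noteq> 0" and z: "integrable lborel z"
    and k: "(k = (\<lambda>x w. complex_LCT_kernel A\<^sub>1 (fst x) (fst w) * cnj (complex_LCT_kernel A\<^sub>2 (snd x) (snd w)))) \<or>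
            (k = (\<lambda>x w. complex_LCT_kernel A\<^sub>1 (fst x) (fst w) * complex_LCT_kernel A\<^sub>2 (snd x) (snd w)))"
  shows planar_LCT_energy: "(\<integral>\<^sup>+x. ennreal ((norm (z x))\<^sup>2) \<partial>lborel) < \<infinity> \<Longrightarrow>
      (\<integral>\<^sup>+w. ennreal ((norm (LINT x|lborel. k x w * z x))\<^sup>2) \<partial>lborel) = (\<integral>\<^sup>+x. ennreal ((norm (z x))\<^sup>2) \<partial>lborel)"
    and planar_LCT_fourth_power: "(\<integral>\<^sup>+w. ennreal ((norm (LINT x|lborel. k x w * z x)) ^ 4) \<partial>lborel) \<le>
      ennreal (1 / (4 * pi\<^sup>2 * \<bar>A\<^sub>1 $ 1 $ 2 * A\<^sub>2 $ 1 $ 2\<bar>)) * (\<integral>\<^sup>+m. (autoconv (\<lambda>x. ennreal (norm (z x))) m)\<^sup>2 \<partial>lborel)"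
proof -
  define b\<^sub>1 b\<^sub>2 where "b\<^sub>1 = A\<^sub>1 $ 1 $ 2" and "b\<^sub>2 = A\<^sub>2 $ 1 $ 2"
  define c\<^sub>1 c\<^sub>2 where "c\<^sub>1 = 1 / csqrt (of_real (2 * pi * b\<^sub>1))" and "c\<^sub>2 = 1 / csqrt (of_real (2 * pi * b\<^sub>2))"
  define a\<^sub>1 a\<^sub>2 d\<^sub>1 d\<^sub>2 where "a\<^sub>1 = A\<^sub>1 $ 1 $ 1" and "a\<^sub>2 = A\<^sub>2 $ 1 $ 1" and "d\<^sub>1 = A\<^sub>1 $ 2 $ 2" and "d\<^sub>2 = A\<^sub>2 $ 2 $ 2"
  note defs = b\<^sub>1_def b\<^sub>2_def a\<^sub>1_def a\<^sub>2_def d\<^sub>1_def d\<^sub>2_def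
  have b0: "b\<^sub>1 \<noteq> 0" "b\<^sub>2 \<noteq> 0" using b by (auto simp: defs)
  have nc: "(norm c\<^sub>1)\<^sup>2 * (norm c\<^sub>2)\<^sup>2 = 1 / (4 * pi\<^sup>2 * \<bar>b\<^sub>1 * b\<^sub>2\<bar>)"
    unfolding c\<^sub>1_def c\<^sub>2_def norm_divide power_divide norm_csqrt_square
    by (simp add: norm_mult abs_mult power2_eq_square)
  obtain C \<alpha> \<beta> s where C: "\<And>x w. k x w = C * cis (\<alpha> x + \<beta> w - (fst x * fst w / b\<^sub>1 + snd x * snd w / s))"
      and nC: "norm C = norm c\<^sub>1 * norm c\<^sub>2" and \<alpha>: "\<alpha> \<in> borel_measurable borel" and s: "s = b\<^sub>2 \<or> s = - b\<^sub>2"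
    using k
  proof
    assume k: "k = (\<lambda>x w. complex_LCT_kernel A\<^sub>1 (fst x) (fst w) * cnj (complex_LCT_kernel A\<^sub>2 (snd x) (snd w)))"
    show thesis
    proof (rule that)
      fix x w :: "real \<times> real"
      have "k x w = (c\<^sub>1 * cnj c\<^sub>2) * (cis (a\<^sub>1 / (2 * b\<^sub>1) * (fst x)\<^sup>2 - fst x * fst w / b\<^sub>1 + d\<^sub>1 / (2 * b\<^sub>1) * (fst w)\<^sup>2 - pi / 4) *
          cnj (cis (a\<^sub>2 / (2 * b\<^sub>2) * (snd x)\<^sup>2 - snd x * snd w / b\<^sub>2 + d\<^sub>2 / (2 * b\<^sub>2) * (snd w)\<^sup>2 - pi / 4)))"
        unfolding k complex_LCT_kernel_def c\<^sub>1_def c\<^sub>2_def defs complex_cnj_mult by (simp only: mult_ac)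
      also have "\<dots> = (c\<^sub>1 * cnj c\<^sub>2) * cis ((a\<^sub>1 / (2 * b\<^sub>1) * (fst x)\<^sup>2 - a\<^sub>2 / (2 * b\<^sub>2) * (snd x)\<^sup>2) +
         (d\<^sub>1 / (2 * b\<^sub>1) * (fst w)\<^sup>2 - d\<^sub>2 / (2 * b\<^sub>2) * (snd w)\<^sup>2) - (fst x * fst w / b\<^sub>1 + snd x * snd w / (- b\<^sub>2)))"
        unfolding cis_cnj cis_mult by (rule arg_cong[of _ _ "\<lambda>t. (c\<^sub>1 * cnj c\<^sub>2) * cis t"]) simp
      finally show "k x w = \<dots>" .
    qed (auto simp: norm_mult)
  next
    assume k: "k = (\<lambda>x w. complex_LCT_kernel A\<^sub>1 (fst x) (fst w) * complex_LCT_kernel A\<^sub>2 (snd x) (snd w))"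
    show thesis
    proof (rule that)
      fix x w :: "real \<times> real"
      have "k x w = (c\<^sub>1 * c\<^sub>2) * (cis (a\<^sub>1 / (2 * b\<^sub>1) * (fst x)\<^sup>2 - fst x * fst w / b\<^sub>1 + d\<^sub>1 / (2 * b\<^sub>1) * (fst w)\<^sup>2 - pi / 4) *
          cis (a\<^sub>2 / (2 * b\<^sub>2) * (snd x)\<^sup>2 - snd x * snd w / b\<^sub>2 + d\<^sub>2 / (2 * b\<^sub>2) * (snd w)\<^sup>2 - pi / 4))"
        unfolding k complex_LCT_kernel_def c\<^sub>1_def c\<^sub>2_def defs by (simp only: mult_ac)
      also have "\<dots> = (c\<^sub>1 * c\<^sub>2) * cis ((a\<^sub>1 / (2 * b\<^sub>1) * (fst x)\<^sup>2 + a\<^sub>2 / (2 * b\<^sub>2) * (snd x)\<^sup>2) +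
         (d\<^sub>1 / (2 * b\<^sub>1) * (fst w)\<^sup>2 + d\<^sub>2 / (2 * b\<^sub>2) * (snd w)\<^sup>2 - pi / 2) - (fst x * fst w / b\<^sub>1 + snd x * snd w / b\<^sub>2))"
        unfolding cis_mult by (rule arg_cong[of _ _ "\<lambda>t. (c\<^sub>1 * c\<^sub>2) * cis t"]) simp
      finally show "k x w = \<dots>" .
    qed (auto simp: norm_mult)
  qed
  have s0: "s \<noteq> 0" and bs: "\<bar>b\<^sub>1 * s\<bar> = \<bar>b\<^sub>1 * b\<^sub>2\<bar>" using s b0 by (auto simp: abs_mult)
  have nC2: "(norm C)\<^sup>2 = 1 / (4 * pi\<^sup>2 * \<bar>b\<^sub>1 * b\<^sub>2\<bar>)"
    using nc by (simp add: nC power_mult_distrib)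
  have C1: "(norm C)\<^sup>2 * (4 * pi\<^sup>2 * \<bar>b\<^sub>1 * s\<bar>) = 1"
    unfolding nC2 bs using b0 by simp
  show "(\<integral>\<^sup>+x. ennreal ((norm (z x))\<^sup>2) \<partial>lborel) < \<infinity> \<Longrightarrow>
      (\<integral>\<^sup>+w. ennreal ((norm (LINT x|lborel. k x w * z x))\<^sup>2) \<partial>lborel) = (\<integral>\<^sup>+x. ennreal ((norm (z x))\<^sup>2) \<partial>lborel)"
    by (rule chirped_kernel_energy[OF C \<alpha> b0(1) s0 C1 z])
  show "(\<integral>\<^sup>+w. ennreal ((norm (LINT x|lborel. k x w * z x)) ^ 4) \<partial>lborel) \<le>
      ennreal (1 / (4 * pi\<^sup>2 * \<bar>A\<^sub>1 $ 1 $ 2 * A\<^sub>2 $ 1 $ 2\<bar>)) * (\<integral>\<^sup>+m. (autoconv (\<lambda>x. ennreal (norm (z x))) m)\<^sup>2 \<partial>lborel)"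
    using chirped_kernel_fourth_power[OF C \<alpha> b0(1) s0 C1 z] unfolding nC2 b\<^sub>1_def b\<^sub>2_def .
qed

section \<open>From moments to entropy\<close>

text \<open>Cauchy--Schwarz in \<open>\<real>\<^sup>2\<close> bounds \<open>|p\<^sub>+| |q\<^sub>+| + |p\<^sub>-| |q\<^sub>-|\<close> by \<open>2 |p| |q|\<close>. Estimating the two coordinates
separately would lose a further factor \<open>2\<close> in the second moment, and nothing would be gained for the entropy.\<close>

lemma autoconv_quat_split_le:
  fixes h :: "real \<times> real \<Rightarrow> quat"
  assumes [measurable]: "h \<in> borel_measurable borel"
  shows "autoconv (\<lambda>x. ennreal (norm (quat_plus (h x)))) m + autoconv (\<lambda>x. ennreal (norm (quat_minus (h x)))) m
     \<le> 2 * autoconv (\<lambda>x. ennreal (norm (h x))) m"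
proof -
  have cs: "norm (quat_plus p) * norm (quat_plus q) + norm (quat_minus p) * norm (quat_minus q) \<le> 2 * (norm p * norm q)" for p q
  proof (rule power2_le_imp_le)
    have cs2: "(a * c + b * d)\<^sup>2 \<le> (a\<^sup>2 + b\<^sup>2) * (c\<^sup>2 + d\<^sup>2)" for a b c d :: real
      using zero_le_power2[of "a * d - b * c"] by (simp add: power2_eq_square algebra_simps)
    have two: "2 * (norm r)\<^sup>2 = (norm (quat_plus r))\<^sup>2 + (norm (quat_minus r))\<^sup>2" for r
      using norm_quat_plus_minus[of r] by simp
    have "(2 * (norm p * norm q))\<^sup>2 = (2 * (norm p)\<^sup>2) * (2 * (norm q)\<^sup>2)"
      by (simp add: power2_eq_square)
    also have "\<dots> = ((norm (quat_plus p))\<^sup>2 + (norm (quat_minus p))\<^sup>2) * ((norm (quat_plus q))\<^sup>2 + (norm (quat_minus q))\<^sup>2)"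
      unfolding two ..
    finally show "(norm (quat_plus p) * norm (quat_plus q) + norm (quat_minus p) * norm (quat_minus q))\<^sup>2 \<le> (2 * (norm p * norm q))\<^sup>2"
      using cs2 by simp
  qed simp
  have "autoconv (\<lambda>x. ennreal (norm (quat_plus (h x)))) m + autoconv (\<lambda>x. ennreal (norm (quat_minus (h x)))) m =
    (\<integral>\<^sup>+x. ennreal (norm (quat_plus (h x)) * norm (quat_plus (h (m - x))) + norm (quat_minus (h x)) * norm (quat_minus (h (m - x)))) \<partial>lborel)"
    unfolding autoconv_def by (subst nn_integral_add[symmetric]) (measurable, simp add: ennreal_mult)
  also have "\<dots> \<le> (\<integral>\<^sup>+x. ennreal (2 * (norm (h x) * norm (h (m - x)))) \<partial>lborel)"
    by (intro nn_integral_mono ennreal_leI cs)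
  also have "\<dots> = 2 * autoconv (\<lambda>x. ennreal (norm (h x))) m"
    unfolding autoconv_def by (subst nn_integral_cmult[symmetric]) (measurable, simp add: ennreal_mult)
  finally show ?thesis .
qed

text \<open>With \<open>t = p / M\<close>, the inequality \<open>ln t \<le> t - 1\<close> bounds \<open>p ln p\<close> by an integrable function. Hence the positive part
of \<open>p ln p\<close> is integrable, and a non-integrable negative part makes the entropy \<open>\<infinity>\<close>.\<close>

lemma entropy_ge:
  fixes p :: "(real \<times> real) \<times> (real \<times> real) \<Rightarrow> real"
  assumes [measurable]: "p \<in> borel_measurable borel" and p0: "\<And>z. p z \<ge> 0" and N: "N > 0" and M: "M > 0"
    and p1: "(\<integral>\<^sup>+z. ennreal (p z) \<partial>lborel) = ennreal N"
    and p2: "(\<integral>\<^sup>+z. ennreal ((p z)\<^sup>2) \<partial>lborel) \<le> ennreal (M * N / 2)"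
  shows "shannon_entropy p \<ge> ereal (N / 2 - N * ln M)"
proof -
  define g where "g z = (p z)\<^sup>2 / M + ln M * p z - p z" for z
  have ip: "integrable lborel p"
    using p1 p0 by (intro integrableI_nonneg) auto
  have ip2: "integrable lborel (\<lambda>z. (p z)\<^sup>2)"
    using p2 by (intro integrableI_nonneg) (auto simp: less_top[symmetric] top_unique)
  have Ip: "(LINT z|lborel. p z) = N"
    using p1 p0 N by (simp add: integral_eq_nn_integral)
  have Ip2: "(LINT z|lborel. (p z)\<^sup>2) \<le> M * N / 2"
  proof -
    have "enn2real (\<integral>\<^sup>+z. ennreal ((p z)\<^sup>2) \<partial>lborel) \<le> M * N / 2"
      using p2 M N by (intro enn2real_leI) auto
    then show ?thesis by (subst integral_eq_nn_integral) auto
  qed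
  have ig: "integrable lborel g" unfolding g_def using ip ip2 by auto
  have Ig: "(LINT z|lborel. g z) \<le> N * ln M - N / 2"
  proof -
    have "(LINT z|lborel. g z) = (LINT z|lborel. (p z)\<^sup>2) / M + ln M * N - N"
      unfolding g_def using ip ip2 Ip by simp
    also have "\<dots> \<le> (M * N / 2) / M + ln M * N - N"
      using Ip2 M by (intro add_mono diff_mono divide_right_mono) auto
    finally show ?thesis using M by (simp add: mult.commute)
  qed
  have le: "ln (p z) * p z \<le> g z" for z
  proof (cases "p z = 0")
    case False
    then have "p z > 0" using p0[of z] by simp
    then have "ln (p z / M) \<le> p z / M - 1" using M by (intro ln_le_minus_one) auto
    then have "ln (p z) \<le> p z / M + ln M - 1" using M \<open>p z > 0\<close> by (simp add: ln_div)
    then have "ln (p z) * p z \<le> (p z / M + ln M - 1) * p z" using p0 by (intro mult_right_mono)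
    then show ?thesis by (simp add: g_def power2_eq_square algebra_simps)
  qed (simp add: g_def)
  define P where "P = (\<integral>\<^sup>+z. ennreal (ln (p z) * p z) \<partial>lborel)"
  define Q where "Q = (\<integral>\<^sup>+z. ennreal (- (ln (p z) * p z)) \<partial>lborel)"
  define Gp where "Gp = (\<integral>\<^sup>+z. ennreal (g z) \<partial>lborel)"
  define Gm where "Gm = (\<integral>\<^sup>+z. ennreal (- g z) \<partial>lborel)"
  have [measurable]: "g \<in> borel_measurable borel" unfolding g_def by measurable
  have Gfin: "Gp < \<infinity>" "Gm < \<infinity>"
    using ig unfolding Gp_def Gm_def real_integrable_def by (auto simp: less_top)
  have "P \<le> Gp" unfolding P_def Gp_def by (intro nn_integral_mono ennreal_leI le)
  then have Pfin: "P < \<infinity>" using Gfin by auto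
  have ent: "shannon_entropy p = - (enn2ereal P - enn2ereal Q)"
    unfolding shannon_entropy_def P_def Q_def nn_integral_completion ..
  show ?thesis
  proof (cases "Q = \<infinity>")
    case True
    then show ?thesis using Pfin unfolding ent by (cases P) (auto simp: enn2ereal_ennreal)
  next
    case False
    have "integrable lborel (\<lambda>z. ln (p z) * p z)"
      using Pfin False unfolding real_integrable_def P_def Q_def by auto
    then have ii: "integrable lborel (\<lambda>z. ln (p z) * p z)" .
    have "enn2real P - enn2real Q = (LINT z|lborel. ln (p z) * p z)"
      using real_lebesgue_integral_def[OF ii] unfolding P_def Q_def by simp
    also have "\<dots> \<le> (LINT z|lborel. g z)"
      using ii ig le by (intro integral_mono)
    finally have "N / 2 - N * ln M \<le> - (enn2real P - enn2real Q)" using Ig by linarith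
    moreover have "shannon_entropy p = ereal (- (enn2real P - enn2real Q))"
      using Pfin False unfolding ent by (cases P; cases Q) (auto simp: enn2ereal_ennreal)
    ultimately show ?thesis by simp
  qed
qed

text \<open>With \<open>L = ln (4 \<pi>\<^sup>2 B) \<ge> 0\<close> the left-hand side is \<open>(ln (4 \<pi>) - L) / (2 \<pi>\<^sup>2)\<close>, so
\<open>ln (4 \<pi>) \<le> \<pi>\<^sup>2\<close> is all that is needed.\<close>

lemma entropy_numerical_gap:
  fixes B :: real
  assumes B: "B \<ge> 1 / (4 * pi\<^sup>2)"
  shows "1 / (2 * pi\<^sup>2) * (ln 2 - ln (2 * pi) - ln B) \<le> 1 / 2 + ln (4 * pi\<^sup>2 * B)"
proof -
  have B0: "B > 0" using B by (auto intro: less_le_trans[rotated])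
  define L where "L = ln (4 * pi\<^sup>2 * B)"
  have "4 * pi\<^sup>2 * B \<ge> 1" using B by (simp add: field_simps)
  then have L: "L \<ge> 0" unfolding L_def by simp
  have L_eq: "L = ln (4 * pi) + ln pi + ln B"
    unfolding L_def using B0 by (simp add: ln_mult power2_eq_square)
  have "ln (4 * pi) \<le> ln (2 ^ 4 :: real)"
    using pi_less_4 by (subst ln_le_cancel_iff) auto
  also have "\<dots> = 4 * ln 2" by (subst ln_realpow) auto
  also have "\<dots> \<le> 4" using ln_2_less_1 by simp
  also have "\<dots> \<le> pi\<^sup>2" using power_mono[of 2 pi 2] pi_gt3 by simp
  finally have le: "ln (4 * pi) \<le> pi\<^sup>2" .
  have "ln 2 - ln (2 * pi) - ln B = ln (4 * pi) - L"
    unfolding L_eq by (simp add: ln_mult)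
  then have "1 / (2 * pi\<^sup>2) * (ln 2 - ln (2 * pi) - ln B) = (ln (4 * pi) - L) / (2 * pi\<^sup>2)" by simp
  also have "\<dots> \<le> pi\<^sup>2 / (2 * pi\<^sup>2)"
    using le L by (intro divide_right_mono) auto
  also have "\<dots> = 1 / 2" by simp
  finally show ?thesis using L unfolding L_def by linarith
qed

text \<open>The constant \<open>c\<close> is \<open>1 / (4 \<pi>\<^sup>2 B)\<close>, the squared absolute value of the product of the two kernels; \<open>c N\<close> is the
Cauchy--Schwarz bound for \<open>|G|\<^sup>2\<close>.\<close>

lemma entropy_bound_borel:
  fixes A\<^sub>1 A\<^sub>2 :: "real^2^2" and f \<phi> :: "real \<times> real \<Rightarrow> quat"
  assumes b: "A\<^sub>1 $ 1 $ 2 \<noteq> 0" "A\<^sub>2 $ 1 $ 2 \<noteq> 0"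
    and [measurable]: "f \<in> borel_measurable borel" "\<phi> \<in> borel_measurable borel"
    and i: "integrable lborel (\<lambda>x. (norm (f x))\<^sup>2)" "integrable lborel (\<lambda>x. (norm (\<phi> x))\<^sup>2)"
    and G: "\<And>w u. G w u = (LINT x|lborel. quat_slice quat_i (complex_LCT_kernel A\<^sub>1 (fst x) (fst w)) *
     (f x * qcnj (\<phi> (x - u))) * quat_slice quat_j (complex_LCT_kernel A\<^sub>2 (snd x) (snd w)))"
  defines "N \<equiv> (LINT x|lborel. (norm (f x))\<^sup>2) * (LINT x|lborel. (norm (\<phi> x))\<^sup>2)"
    and "c \<equiv> 1 / (4 * pi\<^sup>2 * \<bar>A\<^sub>1 $ 1 $ 2 * A\<^sub>2 $ 1 $ 2\<bar>)"
  assumes N: "N > 0"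
  shows "shannon_entropy (\<lambda>(w, u). (norm (G w u))\<^sup>2) \<ge> ereal (N / 2 - N * ln (c * N))"
proof -
  define h where "h u x = f x * qcnj (\<phi> (x - u))" for u x
  define k\<^sub>p where "k\<^sub>p = (\<lambda>x w. complex_LCT_kernel A\<^sub>1 (fst x) (fst w) * cnj (complex_LCT_kernel A\<^sub>2 (snd x) (snd w)))"
  define k\<^sub>m where "k\<^sub>m = (\<lambda>x w. complex_LCT_kernel A\<^sub>1 (fst x) (fst w) * complex_LCT_kernel A\<^sub>2 (snd x) (snd w))"
  \<comment> \<open>The two complex coordinates of \<open>G w u\<close>.\<close>
  define S\<^sub>p where "S\<^sub>p w u = (LINT x|lborel. k\<^sub>p x w * quat_plus (h u x))" for w u
  define S\<^sub>m where "S\<^sub>m w u = (LINT x|lborel. k\<^sub>m x w * quat_minus (h u x))" for w u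
  define p where "p = (\<lambda>(w, u). ((norm (S\<^sub>p w u))\<^sup>2 + (norm (S\<^sub>m w u))\<^sup>2) / 2)"
  have c0: "c > 0" using b by (simp add: c_def)
  have [measurable]: "(\<lambda>(w, u). S\<^sub>p w u) \<in> borel_measurable (borel \<Otimes>\<^sub>M borel)"
    "(\<lambda>(w, u). S\<^sub>m w u) \<in> borel_measurable (borel \<Otimes>\<^sub>M borel)"
    unfolding S\<^sub>p_def S\<^sub>m_def k\<^sub>p_def k\<^sub>m_def h_def by measurable
  have [measurable]: "h u \<in> borel_measurable borel" for u unfolding h_def by measurable
  have p_mp: "p \<in> borel_measurable (borel \<Otimes>\<^sub>M borel)" unfolding p_def by measurable
  then have p_m [measurable]: "p \<in> borel_measurable borel" by (simp add: borel_prod)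
  have p0: "p z \<ge> 0" for z by (simp add: p_def split: prod.split)
  have ih: "integrable lborel (h u)" for u
    unfolding h_def by (rule integrable_windowed[OF _ _ i]) measurable
  have zp: "integrable lborel (\<lambda>x. quat_plus (h u x))" and zm: "integrable lborel (\<lambda>x. quat_minus (h u x))" for u
    by (rule integrable_bounded_linear[OF bounded_linear_quat_plus ih] integrable_bounded_linear[OF bounded_linear_quat_minus ih])+
  have Gp: "(norm (G w u))\<^sup>2 = p (w, u)" for w u
  proof -
    let ?F = "\<lambda>x. quat_slice quat_i (complex_LCT_kernel A\<^sub>1 (fst x) (fst w)) * h u x *
        quat_slice quat_j (complex_LCT_kernel A\<^sub>2 (snd x) (snd w))"
    have iF: "integrable lborel ?F"
    proof (rule Bochner_Integration.integrable_bound)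
      show "integrable lborel (\<lambda>x. norm (1 / csqrt (of_real (2 * pi * A\<^sub>1 $ 1 $ 2))) * norm (h u x) *
          norm (1 / csqrt (of_real (2 * pi * A\<^sub>2 $ 1 $ 2))))"
        using ih by simp
      show "AE x in lborel. norm (?F x) \<le> norm (norm (1 / csqrt (of_real (2 * pi * A\<^sub>1 $ 1 $ 2))) * norm (h u x) *
          norm (1 / csqrt (of_real (2 * pi * A\<^sub>2 $ 1 $ 2))))"
        unfolding norm_mult[of "_ :: quat"] norm_quat_slice complex_LCT_kernel_def norm_mult[of "_ :: complex"] norm_cis
        by (auto simp: abs_mult)
    qed measurable
    have "quat_plus (G w u) = S\<^sub>p w u"
      unfolding G S\<^sub>p_def h_def[symmetric] integral_bounded_linear[OF bounded_linear_quat_plus iF, symmetric]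
        quat_plus_two_sided k\<^sub>p_def ..
    moreover have "quat_minus (G w u) = S\<^sub>m w u"
      unfolding G S\<^sub>m_def h_def[symmetric] integral_bounded_linear[OF bounded_linear_quat_minus iF, symmetric]
        quat_minus_two_sided k\<^sub>m_def ..
    ultimately show ?thesis unfolding norm_quat_plus_minus p_def by simp
  qed
  \<comment> \<open>The moments of \<open>p\<close> on the slice of fixed \<open>u\<close> are controlled by \<open>H u\<close> and \<open>K u\<close>.\<close>
  define H where "H u = (\<integral>\<^sup>+x. ennreal ((norm (h u x))\<^sup>2) \<partial>lborel)" for u
  define K where "K u = (\<integral>\<^sup>+m. (autoconv (\<lambda>x. ennreal (norm (h u x))) m)\<^sup>2 \<partial>lborel)" for u
  have nn: "(\<integral>\<^sup>+x. (ennreal (norm (f x)))\<^sup>2 \<partial>lborel) * (\<integral>\<^sup>+x. (ennreal (norm (\<phi> x)))\<^sup>2 \<partial>lborel) = ennreal N"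
    unfolding N_def ennreal_power[OF norm_ge_zero]
    by (subst (1 2) nn_integral_eq_integral) (use i in \<open>auto simp: ennreal_mult\<close>)
  have intH: "(\<integral>\<^sup>+u. H u \<partial>lborel) = ennreal N"
  proof -
    have "(\<integral>\<^sup>+u. H u \<partial>lborel) = (\<integral>\<^sup>+u. (\<integral>\<^sup>+x. (ennreal (norm (f x)))\<^sup>2 * (ennreal (norm (\<phi> (x - u))))\<^sup>2 \<partial>lborel) \<partial>lborel)"
      unfolding H_def h_def by (simp add: norm_mult power_mult_distrib ennreal_mult ennreal_power)
    also have "\<dots> = (\<integral>\<^sup>+x. (\<integral>\<^sup>+u. (ennreal (norm (f x)))\<^sup>2 * (ennreal (norm (\<phi> (x - u))))\<^sup>2 \<partial>lborel) \<partial>lborel)"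
      by (rule lborel_pair.Fubini') measurable
    also have "\<dots> = (\<integral>\<^sup>+x. (ennreal (norm (f x)))\<^sup>2 * (\<integral>\<^sup>+u. (ennreal (norm (\<phi> u)))\<^sup>2 \<partial>lborel) \<partial>lborel)"
      by (simp add: nn_integral_cmult nn_integral_lborel_reflect[of "\<lambda>u. (ennreal (norm (\<phi> u)))\<^sup>2"])
    also have "\<dots> = ennreal N"
      by (simp add: nn_integral_multc nn)
    finally show ?thesis .
  qed
  have intK: "4 * (\<integral>\<^sup>+u. K u \<partial>lborel) \<le> ennreal (N\<^sup>2)"
  proof -
    have "(\<integral>\<^sup>+u. K u \<partial>lborel) = (\<integral>\<^sup>+u. (\<integral>\<^sup>+m. (autoconv (\<lambda>x. ennreal (norm (f x)) * ennreal (norm (\<phi> (x - u)))) m)\<^sup>2 \<partial>lborel) \<partial>lborel)"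
      unfolding K_def h_def by (simp add: norm_mult ennreal_mult)
    then have "4 * (\<integral>\<^sup>+u. K u \<partial>lborel) \<le> (\<integral>\<^sup>+x. (ennreal (norm (f x)))\<^sup>2 \<partial>lborel)\<^sup>2 * (\<integral>\<^sup>+x. (ennreal (norm (\<phi> x)))\<^sup>2 \<partial>lborel)\<^sup>2"
      using nn_integral_autoconv_windowed[of "\<lambda>x. ennreal (norm (f x))" "\<lambda>x. ennreal (norm (\<phi> x))"] by simp
    also have "\<dots> = ennreal (N\<^sup>2)"
      unfolding power_mult_distrib[symmetric] nn using N by (simp add: ennreal_power)
    finally show ?thesis .
  qed
  have [measurable]: "H \<in> borel_measurable borel" "K \<in> borel_measurable borel"
    unfolding H_def K_def h_def autoconv_def by measurable
  have slice1: "(\<integral>\<^sup>+w. ennreal (p (w, u)) \<partial>lborel) = H u" if fin: "H u < \<infinity>" for u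
  proof -
    let ?Z\<^sub>p = "\<integral>\<^sup>+x. ennreal ((norm (quat_plus (h u x)))\<^sup>2) \<partial>lborel"
    let ?Z\<^sub>m = "\<integral>\<^sup>+x. ennreal ((norm (quat_minus (h u x)))\<^sup>2) \<partial>lborel"
    have halves: "(\<integral>\<^sup>+x. ennreal ((a x + b x) / 2) \<partial>lborel) =
       ennreal (1 / 2) * ((\<integral>\<^sup>+x. ennreal (a x) \<partial>lborel) + (\<integral>\<^sup>+x. ennreal (b x) \<partial>lborel))"
      if [measurable]: "a \<in> borel_measurable borel" "b \<in> borel_measurable borel"
        and "\<And>x. a x \<ge> 0" "\<And>x. b x \<ge> 0" for a b :: "real \<times> real \<Rightarrow> real"
    proof -
      have "ennreal ((a x + b x) / 2) = ennreal (1 / 2) * (ennreal (a x) + ennreal (b x))" for x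
      proof -
        have "ennreal ((a x + b x) / 2) = ennreal (1 / 2 * (a x + b x))" by simp
        also have "\<dots> = ennreal (1 / 2) * (ennreal (a x) + ennreal (b x))"
          using that(3,4)[of x] by (subst ennreal_mult) auto
        finally show ?thesis .
      qed
      then show ?thesis by (simp add: nn_integral_cmult nn_integral_add)
    qed
    have H: "H u = ennreal (1 / 2) * (?Z\<^sub>p + ?Z\<^sub>m)"
      unfolding H_def norm_quat_plus_minus by (rule halves) auto
    have "?Z\<^sub>p < \<infinity>" "?Z\<^sub>m < \<infinity>"
      using fin unfolding H by (auto simp: ennreal_mult_less_top)
    then have "(\<integral>\<^sup>+w. ennreal ((norm (S\<^sub>p w u))\<^sup>2) \<partial>lborel) = ?Z\<^sub>p" "(\<integral>\<^sup>+w. ennreal ((norm (S\<^sub>m w u))\<^sup>2) \<partial>lborel) = ?Z\<^sub>m"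
      unfolding S\<^sub>p_def S\<^sub>m_def k\<^sub>p_def k\<^sub>m_def
      by (intro planar_LCT_energy[OF b zp] planar_LCT_energy[OF b zm]; simp)+
    then show ?thesis
      unfolding p_def prod.case H by (subst halves) auto
  qed
  have slice2: "(\<integral>\<^sup>+w. ennreal ((p (w, u))\<^sup>2) \<partial>lborel) \<le> ennreal (2 * c) * K u" for u
  proof -
    let ?a\<^sub>p = "autoconv (\<lambda>x. ennreal (norm (quat_plus (h u x))))"
    let ?a\<^sub>m = "autoconv (\<lambda>x. ennreal (norm (quat_minus (h u x))))"
    have Sp4: "(\<integral>\<^sup>+w. ennreal ((norm (S\<^sub>p w u)) ^ 4) \<partial>lborel) \<le> ennreal c * (\<integral>\<^sup>+m. (?a\<^sub>p m)\<^sup>2 \<partial>lborel)"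
      unfolding S\<^sub>p_def k\<^sub>p_def c_def by (rule planar_LCT_fourth_power[OF b zp]) simp
    have Sm4: "(\<integral>\<^sup>+w. ennreal ((norm (S\<^sub>m w u)) ^ 4) \<partial>lborel) \<le> ennreal c * (\<integral>\<^sup>+m. (?a\<^sub>m m)\<^sup>2 \<partial>lborel)"
      unfolding S\<^sub>m_def k\<^sub>m_def c_def by (rule planar_LCT_fourth_power[OF b zm]) simp
    have pw: "ennreal ((p (w, u))\<^sup>2) \<le> ennreal (1 / 2) * (ennreal ((norm (S\<^sub>p w u)) ^ 4) + ennreal ((norm (S\<^sub>m w u)) ^ 4))" for w
    proof -
      have "((a + b) / 2)\<^sup>2 \<le> 1 / 2 * (a\<^sup>2 + b\<^sup>2)" for a b :: real
        using zero_le_power2[of "a - b"] by (simp add: power2_eq_square field_simps)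
      from this[of "(norm (S\<^sub>p w u))\<^sup>2" "(norm (S\<^sub>m w u))\<^sup>2"]
      have "(p (w, u))\<^sup>2 \<le> 1 / 2 * (norm (S\<^sub>p w u) ^ 4 + norm (S\<^sub>m w u) ^ 4)"
        unfolding p_def by (simp flip: power_mult)
      then have "ennreal ((p (w, u))\<^sup>2) \<le> ennreal (1 / 2 * (norm (S\<^sub>p w u) ^ 4 + norm (S\<^sub>m w u) ^ 4))"
        by (rule ennreal_leI)
      then show ?thesis by (subst (asm) ennreal_mult) auto
    qed
    have "(\<integral>\<^sup>+w. ennreal ((p (w, u))\<^sup>2) \<partial>lborel)
       \<le> (\<integral>\<^sup>+w. ennreal (1 / 2) * (ennreal ((norm (S\<^sub>p w u)) ^ 4) + ennreal ((norm (S\<^sub>m w u)) ^ 4)) \<partial>lborel)"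
      by (intro nn_integral_mono pw)
    also have "\<dots> = ennreal (1 / 2) * ((\<integral>\<^sup>+w. ennreal ((norm (S\<^sub>p w u)) ^ 4) \<partial>lborel) + (\<integral>\<^sup>+w. ennreal ((norm (S\<^sub>m w u)) ^ 4) \<partial>lborel))"
      by (simp add: nn_integral_cmult nn_integral_add)
    also have "\<dots> \<le> ennreal (1 / 2) * (ennreal c * (\<integral>\<^sup>+m. (?a\<^sub>p m)\<^sup>2 \<partial>lborel) + ennreal c * (\<integral>\<^sup>+m. (?a\<^sub>m m)\<^sup>2 \<partial>lborel))"
      by (intro mult_left_mono add_mono Sp4 Sm4) simp
    also have "\<dots> = ennreal (1 / 2) * (ennreal c * (\<integral>\<^sup>+m. (?a\<^sub>p m)\<^sup>2 + (?a\<^sub>m m)\<^sup>2 \<partial>lborel))"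
      by (simp add: nn_integral_add distrib_left)
    also have "\<dots> \<le> ennreal (1 / 2) * (ennreal c * (\<integral>\<^sup>+m. 4 * (autoconv (\<lambda>x. ennreal (norm (h u x))) m)\<^sup>2 \<partial>lborel))"
    proof (intro mult_left_mono nn_integral_mono)
      fix m
      have "(?a\<^sub>p m)\<^sup>2 + (?a\<^sub>m m)\<^sup>2 \<le> (?a\<^sub>p m + ?a\<^sub>m m)\<^sup>2"
        unfolding power2_eq_square by (simp add: distrib_left distrib_right add_increasing2 add_mono add_increasing)
      also have "\<dots> \<le> (2 * autoconv (\<lambda>x. ennreal (norm (h u x))) m)\<^sup>2"
        by (intro power_mono autoconv_quat_split_le) auto
      also have "\<dots> = 4 * (autoconv (\<lambda>x. ennreal (norm (h u x))) m)\<^sup>2"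
        by (simp add: power_mult_distrib)
      finally show "(?a\<^sub>p m)\<^sup>2 + (?a\<^sub>m m)\<^sup>2 \<le> 4 * (autoconv (\<lambda>x. ennreal (norm (h u x))) m)\<^sup>2" .
    qed auto
    also have "\<dots> = (ennreal (1 / 2) * ennreal c * 4) * K u"
      unfolding K_def by (simp add: nn_integral_cmult mult.assoc)
    also have "ennreal (1 / 2) * ennreal c * 4 = ennreal (2 * c)"
    proof -
      have "ennreal (2 * c) = ennreal (1 / 2 * c * 4)" by simp
      also have "\<dots> = ennreal (1 / 2) * ennreal c * ennreal 4"
        using c0 by (subst ennreal_mult, simp, simp, subst ennreal_mult) auto
      finally show ?thesis by simp
    qed
    finally show ?thesis .
  qed
  have p1: "(\<integral>\<^sup>+z. ennreal (p z) \<partial>lborel) = ennreal N"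
  proof -
    \<comment> \<open>Plancherel's theorem needs \<open>h u \<in> L\<^sup>2\<close>, which holds only for almost every \<open>u\<close>.\<close>
    have "AE u in lborel. H u \<noteq> \<infinity>"
      using intH by (intro nn_integral_PInf_AE) auto
    then have "AE u in lborel. (\<integral>\<^sup>+w. ennreal (p (w, u)) \<partial>lborel) = H u"
      by eventually_elim (simp add: slice1 less_top)
    then have "(\<integral>\<^sup>+u. (\<integral>\<^sup>+w. ennreal (p (w, u)) \<partial>lborel) \<partial>lborel) = ennreal N"
      unfolding intH[symmetric] by (rule nn_integral_cong_AE)
    then show ?thesis
      using lborel_pair.nn_integral_snd[of "\<lambda>z. ennreal (p z)"] by (simp add: lborel_prod)
  qed
  have p2: "(\<integral>\<^sup>+z. ennreal ((p z)\<^sup>2) \<partial>lborel) \<le> ennreal ((c * N) * N / 2)"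
  proof -
    have "(\<integral>\<^sup>+z. ennreal ((p z)\<^sup>2) \<partial>lborel) = (\<integral>\<^sup>+u. (\<integral>\<^sup>+w. ennreal ((p (w, u))\<^sup>2) \<partial>lborel) \<partial>lborel)"
      using lborel_pair.nn_integral_snd[of "\<lambda>z. ennreal ((p z)\<^sup>2)"] by (simp add: lborel_prod)
    also have "\<dots> \<le> (\<integral>\<^sup>+u. ennreal (2 * c) * K u \<partial>lborel)"
      by (intro nn_integral_mono slice2)
    also have "\<dots> = ennreal (c / 2) * (4 * (\<integral>\<^sup>+u. K u \<partial>lborel))"
    proof -
      have "ennreal (2 * c) = ennreal (c / 2) * 4"
        using c0 by (simp flip: ennreal_mult ennreal_numeral)
      then show ?thesis by (simp add: nn_integral_cmult mult.assoc)
    qed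
    also have "\<dots> \<le> ennreal (c / 2) * ennreal (N\<^sup>2)"
      by (intro mult_left_mono intK) simp
    also have "\<dots> = ennreal ((c * N) * N / 2)"
      using c0 N by (simp flip: ennreal_mult add: power2_eq_square mult_ac)
    finally show ?thesis .
  qed
  have "shannon_entropy p \<ge> ereal (N / 2 - N * ln (c * N))"
    using c0 N by (intro entropy_ge p0 p1 p2) auto
  moreover have "(\<lambda>(w, u). (norm (G w u))\<^sup>2) = p"
    by (auto simp: Gp fun_eq_iff)
  ultimately show ?thesis by simp
qed

lemma L2_borel_representative:
  assumes "L2_fun f" "L2_nonzero f"
  obtains f' where "f' \<in> borel_measurable borel" "AE x in lborel. f x = f' x"
    "integrable lborel (\<lambda>x. (norm (f' x))\<^sup>2)" "(LINT x|lborel. (norm (f' x))\<^sup>2) = (L2_norm f)\<^sup>2"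
    "L2_norm f > 0"
proof -
  have f [measurable]: "f \<in> borel_measurable lebesgue" and i: "integrable lebesgue (\<lambda>x. (norm (f x))\<^sup>2)"
    using assms(1) by (auto simp: L2_fun_def)
  obtain f' where f' [measurable]: "f' \<in> borel_measurable borel" and ae: "AE x in lborel. f x = f' x"
    using lebesgue_ex_borel[OF f] by auto
  have ae2: "AE x in lebesgue. (norm (f x))\<^sup>2 = (norm (f' x))\<^sup>2"
    using AE_completion[OF ae] by eventually_elim simp
  have m [measurable]: "(\<lambda>x. (norm (f' x))\<^sup>2) \<in> borel_measurable lborel" by measurable
  have [measurable]: "(\<lambda>x. (norm (f' x))\<^sup>2) \<in> borel_measurable lebesgue" by (rule measurable_completion[OF m])
  have "integrable lebesgue (\<lambda>x. (norm (f' x))\<^sup>2)"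
    using i ae2 by (subst (asm) integrable_cong_AE) auto
  then have i': "integrable lborel (\<lambda>x. (norm (f' x))\<^sup>2)"
    using integrable_completion[OF m] by simp
  have "(LINT x|lebesgue. (norm (f x))\<^sup>2) = (LINT x|lebesgue. (norm (f' x))\<^sup>2)"
    using ae2 by (intro integral_cong_AE) auto
  also have "\<dots> = (LINT x|lborel. (norm (f' x))\<^sup>2)"
    by (rule integral_completion[OF m])
  finally have eq: "(LINT x|lebesgue. (norm (f x))\<^sup>2) = (LINT x|lborel. (norm (f' x))\<^sup>2)" .
  have "(LINT x|lebesgue. (norm (f x))\<^sup>2) \<noteq> 0"
    using assms(2) i unfolding L2_nonzero_def by (subst integral_nonneg_eq_0_iff_AE) auto
  then have "(LINT x|lebesgue. (norm (f x))\<^sup>2) > 0" by (auto simp: less_le)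
  then have "L2_norm f > 0" unfolding L2_norm_def by simp
  moreover have "(LINT x|lborel. (norm (f' x))\<^sup>2) = (L2_norm f)\<^sup>2"
    by (simp add: L2_norm_def eq)
  ultimately show thesis by (intro that[OF f' ae i'])
qed

theorem theorem4:
  fixes A\<^sub>1 A\<^sub>2 :: "real^2^2" and f \<phi> :: "real \<times> real \<Rightarrow> quat"
  assumes "det A\<^sub>1 = 1" and "det A\<^sub>2 = 1"
    and "A\<^sub>1 $ 1 $ 2 \<noteq> 0" and "A\<^sub>2 $ 1 $ 2 \<noteq> 0"
    and "L2_fun \<phi>" and "L2_nonzero \<phi>"
    and "L2_fun f" and "L2_nonzero f"
    and "\<bar>A\<^sub>1 $ 1 $ 2 * A\<^sub>2 $ 1 $ 2\<bar> \<ge> 1 / (4 * pi\<^sup>2)"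
  shows "shannon_entropy (\<lambda>(w, u). (norm (QWLCT A\<^sub>1 A\<^sub>2 \<phi> f w u))\<^sup>2) \<ge>
    ereal (1 / (2 * pi\<^sup>2) * (ln 2 - ln (2 * pi) - ln \<bar>A\<^sub>1 $ 1 $ 2 * A\<^sub>2 $ 1 $ 2\<bar>)
             * (L2_norm f)\<^sup>2 * (L2_norm \<phi>)\<^sup>2
           - (L2_norm f)\<^sup>2 * (L2_norm \<phi>)\<^sup>2 * ln ((L2_norm f)\<^sup>2 * (L2_norm \<phi>)\<^sup>2))"
proof -
  note b = assms(3,4)
  obtain f' where f': "f' \<in> borel_measurable borel" "AE x in lborel. f x = f' x"
    "integrable lborel (\<lambda>x. (norm (f' x))\<^sup>2)" "(LINT x|lborel. (norm (f' x))\<^sup>2) = (L2_norm f)\<^sup>2" "L2_norm f > 0"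
    using L2_borel_representative[OF assms(7,8)] by blast
  obtain \<phi>' where \<phi>': "\<phi>' \<in> borel_measurable borel" "AE x in lborel. \<phi> x = \<phi>' x"
    "integrable lborel (\<lambda>x. (norm (\<phi>' x))\<^sup>2)" "(LINT x|lborel. (norm (\<phi>' x))\<^sup>2) = (L2_norm \<phi>)\<^sup>2" "L2_norm \<phi> > 0"
    using L2_borel_representative[OF assms(5,6)] by blast
  have m: "f \<in> borel_measurable lebesgue" "\<phi> \<in> borel_measurable lebesgue"
    using assms by (auto simp: L2_fun_def)
  define N where "N = (L2_norm f)\<^sup>2 * (L2_norm \<phi>)\<^sup>2"
  define B where "B = \<bar>A\<^sub>1 $ 1 $ 2 * A\<^sub>2 $ 1 $ 2\<bar>"
  have N: "N > 0" and B: "B > 0" "B \<ge> 1 / (4 * pi\<^sup>2)"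
    using f'(5) \<phi>'(5) assms by (auto simp: N_def B_def)
  have "shannon_entropy (\<lambda>(w, u). (norm (QWLCT A\<^sub>1 A\<^sub>2 \<phi> f w u))\<^sup>2) \<ge> ereal (N / 2 - N * ln (1 / (4 * pi\<^sup>2 * B) * N))"
    using entropy_bound_borel[OF b f'(1) \<phi>'(1) f'(3) \<phi>'(3) QWLCT_eq_borel_representatives[OF b m f'(1) \<phi>'(1) f'(2) \<phi>'(2)]] N
    unfolding f'(4) \<phi>'(4) N_def B_def by simp
  moreover have "1 / (2 * pi\<^sup>2) * (ln 2 - ln (2 * pi) - ln B) * N - N * ln N \<le> N / 2 - N * ln (1 / (4 * pi\<^sup>2 * B) * N)"
  proof -
    have "ln (1 / (4 * pi\<^sup>2 * B) * N) = ln N - ln (4 * pi\<^sup>2 * B)"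
      using N B by (simp add: ln_div)
    then have "N * ln (1 / (4 * pi\<^sup>2 * B) * N) = N * ln N - N * ln (4 * pi\<^sup>2 * B)"
      by (simp only: right_diff_distrib)
    moreover have "1 / (2 * pi\<^sup>2) * (ln 2 - ln (2 * pi) - ln B) * N \<le> (1 / 2 + ln (4 * pi\<^sup>2 * B)) * N"
      using N by (intro mult_right_mono entropy_numerical_gap B) auto
    then have "1 / (2 * pi\<^sup>2) * (ln 2 - ln (2 * pi) - ln B) * N \<le> N / 2 + N * ln (4 * pi\<^sup>2 * B)"
      by (simp only: distrib_right mult.commute[of _ N]) (simp add: distrib_left)
    ultimately show ?thesis by linarith
  qed
  ultimately show ?thesis
    unfolding N_def[symmetric] B_def[symmetric] mult.assoc[of _ "(L2_norm f)\<^sup>2"]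
    by (meson ereal_less_eq(3) order_trans)
qed

end
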